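(* Let $\dot{\mathbf{A}}\in\mathbb{H}^{M\times N}$ have quaternion singular values $\sigma_1\ge\sigma_2\ge\cdots\ge 0$, and let $K,l,P,p$ be integers with $1\le K\le l\le\min(M,N)$, $P\ge 0$, $2\le P+K\le l$ and $p\ge 1$. Let $\hat{\dot{\mathbf{A}}}_{CoR}=\dot{\mathbf{Q}}_1\dot{\mathbf{Q}}_1^H\dot{\mathbf{A}}\dot{\mathbf{Q}}_2\dot{\mathbf{Q}}_2^H$ be the (random) approximation of $\dot{\mathbf{A}}$ produced by the CoR-QURV algorithm with parameters $l$ and $p$. Then $$\mathbb{E}\|\dot{\mathbf{A}}-\hat{\dot{\mathbf{A}}}_{CoR}\|_F\le\|\dot{\mathbf{A}}_0\|_F+(1+\gamma_K)\sqrt{K}\,\nu\,\sigma_{l-P+1}\,\gamma_K,$$ where $\dot{\mathbf{A}}_0=\dot{\mathbf{A}}-\dot{\mathbf{A}}_K$, $\displaystyle\nu=\bigl(3(\sqrt{N}+\sqrt{N})+3\bigr)\frac{e\sqrt{4N+2}}{P+1}$ and $\displaystyle\gamma_K=\frac{\sigma_{l-P+1}}{\sigma_K}$.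
   Context: $\mathbb{H}$ denotes the real quaternions; $^H$ is conjugate transpose and $\|\cdot\|_F$ the Frobenius norm. The quaternion singular values are those of the quaternion singular value decomposition $\dot{\mathbf{A}}=\dot{\mathbf{U}}\mathbf{\Sigma}\dot{\mathbf{V}}^H$ (with $\dot{\mathbf{U}},\dot{\mathbf{V}}$ unitary and $\mathbf{\Sigma}$ real diagonal), in decreasing order; $\sigma_K>0$ so that $\gamma_K$ is defined, and $\sigma_i=0$ for $i>\min(M,N)$. $\dot{\mathbf{A}}_K$ is the best rank-$K$ approximation of $\dot{\mathbf{A}}$ given by truncating the QSVD. Here $e$ is the base of the natural logarithm. CoR-QURV algorithm: draw $\dot{\mathbf{\Omega}}=\mathbf{\Omega}_0+\mathbf{\Omega}_1 i+\mathbf{\Omega}_2 j+\mathbf{\Omega}_3 k\in\mathbb{H}^{N\times l}$, where $\mathbf{\Omega}_0,\dots,\mathbf{\Omega}_3$ are independent real matrices with independent $N(0,1)$ entries. Set $\dot{\mathbf{Y}}_0=\dot{\mathbf{A}}\dot{\mathbf{\Omega}}$ and, for $i=1,\dots,p$, $\hat{\dot{\mathbf{Y}}}_i=\dot{\mathbf{A}}^H\dot{\mathbf{Y}}_{i-1}$ and $\dot{\mathbf{Y}}_i=\dot{\mathbf{A}}\hat{\dot{\mathbf{Y}}}_i$. Compute thin quaternion QR factorizations $\dot{\mathbf{Y}}_p=\dot{\mathbf{Q}}_1\dot{\mathbf{R}}_1$ and $\hat{\dot{\mathbf{Y}}}_p=\dot{\mathbf{Q}}_2\dot{\mathbf{R}}_2$,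 where $\dot{\mathbf{Q}}_1\in\mathbb{H}^{M\times l}$ and $\dot{\mathbf{Q}}_2\in\mathbb{H}^{N\times l}$ have orthonormal columns. Put $\dot{\mathbf{M}}=\dot{\mathbf{Q}}_1^H\dot{\mathbf{A}}\dot{\mathbf{Q}}_2$, compute a column-pivoted QR factorization $\dot{\mathbf{M}}=\dot{\mathbf{Q}}_3\dot{\mathbf{R}}_3\mathbf{P}^T$ with $\mathbf{P}$ a permutation matrix; the resulting approximation is $\hat{\dot{\mathbf{A}}}_{CoR}=(\dot{\mathbf{Q}}_1\dot{\mathbf{Q}}_3)\dot{\mathbf{R}}_3(\dot{\mathbf{Q}}_2\mathbf{P})^H=\dot{\mathbf{Q}}_1\dot{\mathbf{M}}\dot{\mathbf{Q}}_2^H$. The expectation is over $\dot{\mathbf{\Omega}}$. *)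

theory Defs
  imports "HOL-Probability.Probability" "HOL-Combinatorics.Permutations"
    "Jordan_Normal_Form.Matrix"
begin

section \<open>Real quaternions\<close>

text \<open>\<open>Quat a b c d\<close> stands for $a + b i + c j + d k$.\<close>

datatype quat = Quat (q_re: real) (q_i: real) (q_j: real) (q_k: real)

lemma quat_eq_iff:
  "x = y \<longleftrightarrow> q_re x = q_re y \<and> q_i x = q_i y \<and> q_j x = q_j y \<and> q_k x = q_k y"
  by (cases x; cases y) auto

instantiation quat :: ring_1
begin

definition "0 = Quat 0 0 0 0"
definition "1 = Quat 1 0 0 0"
definition "x + y = Quat (q_re x + q_re y) (q_i x + q_i y) (q_j x + q_j y) (q_k x + q_k y)"
definition "- x = Quat (- q_re x) (- q_i x) (- q_j x) (- q_k x)"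
definition "x - y = Quat (q_re x - q_re y) (q_i x - q_i y) (q_j x - q_j y) (q_k x - q_k y)"
definition "x * y = Quat
  (q_re x * q_re y - q_i x * q_i y - q_j x * q_j y - q_k x * q_k y)
  (q_re x * q_i y + q_i x * q_re y + q_j x * q_k y - q_k x * q_j y)
  (q_re x * q_j y - q_i x * q_k y + q_j x * q_re y + q_k x * q_i y)
  (q_re x * q_k y + q_i x * q_j y - q_j x * q_i y + q_k x * q_re y)"

lemmas quat_ops = zero_quat_def one_quat_def plus_quat_def uminus_quat_def minus_quat_def
  times_quat_def

instance
  by standard (simp_all add: quat_ops algebra_simps)

end

definition qcnj :: "quat \<Rightarrow> quat" where
  "qcnj x = Quat (q_re x) (- q_i x) (- q_j x) (- q_k x)"

lemma qcnj_mult: "qcnj (x * y) = qcnj y * qcnj x"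
  by (simp add: qcnj_def times_quat_def algebra_simps)

lemma qcnj_qcnj [simp]: "qcnj (qcnj x) = x"
  by (simp add: qcnj_def)

lemma qcnj_0 [simp]: "qcnj 0 = 0"
  by (simp add: qcnj_def zero_quat_def)

lemma qcnj_add: "qcnj (x + y) = qcnj x + qcnj y"
  by (simp add: qcnj_def plus_quat_def)

lemma qcnj_sum: "qcnj (sum f A) = (\<Sum>x\<in>A. qcnj (f x))"
  by (induction A rule: infinite_finite_induct) (simp_all add: qcnj_add)

instantiation quat :: real_vector
begin

definition "scaleR r x = Quat (r * q_re x) (r * q_i x) (r * q_j x) (r * q_k x)"

instance
  by standard (simp_all add: scaleR_quat_def plus_quat_def algebra_simps)

end

instantiation quat :: real_normed_vector
begin

definition "norm x = sqrt ((q_re x)\<^sup>2 + (q_i x)\<^sup>2 + (q_j x)\<^sup>2 + (q_k x)\<^sup>2)"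
definition "sgn x = x /\<^sub>R norm (x :: quat)"
definition "dist x y = norm (x - y :: quat)"
definition "uniformity = (INF e\<in>{0<..}. principal {(x, y). dist x (y :: quat) < e})"
definition "open U = (\<forall>x\<in>U. \<forall>\<^sub>F (x', y) in uniformity. x' = x \<longrightarrow> y \<in> (U :: quat set))"

instance
proof
  fix x y :: quat and a b :: real and U :: "quat set"
  have n4: "norm z = norm ((Complex (q_re z) (q_i z), Complex (q_j z) (q_k z)))" for z :: quat
    by (simp add: norm_quat_def norm_Pair cmod_def add.assoc)
  show "norm x = 0 \<longleftrightarrow> x = 0"
    by (simp add: n4 quat_eq_iff zero_quat_def complex_eq_iff zero_prod_def)
  have "norm (x + y) = norm ((Complex (q_re x) (q_i x), Complex (q_j x) (q_k x))
      + (Complex (q_re y) (q_i y), Complex (q_j y) (q_k y)))"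
    by (simp add: n4 plus_quat_def complex_add)
  then show "norm (x + y) \<le> norm x + norm y"
    by (metis n4 norm_triangle_ineq)
  have "norm (a *\<^sub>R x) = norm (a *\<^sub>R (Complex (q_re x) (q_i x), Complex (q_j x) (q_k x)))"
    unfolding n4 by (simp add: scaleR_quat_def complex_eq_iff scaleR_prod_def)
       (simp add: complex_scaleR)
  then show "norm (a *\<^sub>R x) = \<bar>a\<bar> * norm x"
    by (metis n4 norm_scaleR)
qed (rule sgn_quat_def dist_quat_def uniformity_quat_def open_quat_def)+

end


section \<open>Quaternion matrices\<close>

definition mat_H :: "quat mat \<Rightarrow> quat mat" ("_\<^sup>H" [1000] 1000) where
  "A\<^sup>H = mat (dim_col A) (dim_row A) (\<lambda>(i, j). qcnj (A $$ (j, i)))"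

lemma mat_H_carrier: "A \<in> carrier_mat m n \<Longrightarrow> A\<^sup>H \<in> carrier_mat n m"
  by (auto simp: mat_H_def)

lemma mat_H_mult:
  assumes "A \<in> carrier_mat m n" "B \<in> carrier_mat n k"
  shows "(A * B)\<^sup>H = B\<^sup>H * A\<^sup>H"
  using assms
  by (intro eq_matI) (auto simp: mat_H_def scalar_prod_def qcnj_sum qcnj_mult)

definition frob_norm :: "quat mat \<Rightarrow> real" where
  "frob_norm A = sqrt (\<Sum>i<dim_row A. \<Sum>j<dim_col A. (norm (A $$ (i, j)))\<^sup>2)"

definition quat_mat :: "real mat \<Rightarrow> real mat \<Rightarrow> real mat \<Rightarrow> real mat \<Rightarrow> quat mat" where
  "quat_mat W0 W1 W2 W3 = mat (dim_row W0) (dim_col W0)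
     (\<lambda>(i, j). Quat (W0 $$ (i, j)) (W1 $$ (i, j)) (W2 $$ (i, j)) (W3 $$ (i, j)))"

definition unitary_quat_mat :: "nat \<Rightarrow> quat mat \<Rightarrow> bool" where
  "unitary_quat_mat n U \<longleftrightarrow> U \<in> carrier_mat n n \<and> U * U\<^sup>H = 1\<^sub>m n \<and> U\<^sup>H * U = 1\<^sub>m n"

definition orthonormal_cols :: "nat \<Rightarrow> nat \<Rightarrow> quat mat \<Rightarrow> bool" where
  "orthonormal_cols m l Q \<longleftrightarrow> Q \<in> carrier_mat m l \<and> Q\<^sup>H * Q = 1\<^sub>m l"


section \<open>Quaternion singular value decomposition\<close>

text \<open>Singular values are indexed from 1, whereas matrix indices start at 0.\<close>

definition sigma_mat :: "nat \<Rightarrow> nat \<Rightarrow> (nat \<Rightarrow> real) \<Rightarrow> quat mat" where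
  "sigma_mat m n \<sigma> = mat m n (\<lambda>(i, j). if i = j then Quat (\<sigma> (i + 1)) 0 0 0 else 0)"

definition is_qsvd ::
  "nat \<Rightarrow> nat \<Rightarrow> quat mat \<Rightarrow> quat mat \<Rightarrow> (nat \<Rightarrow> real) \<Rightarrow> quat mat \<Rightarrow> bool" where
  "is_qsvd m n A U \<sigma> V \<longleftrightarrow>
     A \<in> carrier_mat m n \<and> unitary_quat_mat m U \<and> unitary_quat_mat n V \<and>
     (\<forall>i j. 1 \<le> i \<longrightarrow> i \<le> j \<longrightarrow> \<sigma> j \<le> \<sigma> i) \<and> (\<forall>i. 0 \<le> \<sigma> i) \<and> (\<forall>i > min m n. \<sigma> i = 0) \<and>
     A = U * sigma_mat m n \<sigma> * V\<^sup>H"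

definition qsvd_truncation ::
  "nat \<Rightarrow> nat \<Rightarrow> quat mat \<Rightarrow> (nat \<Rightarrow> real) \<Rightarrow> quat mat \<Rightarrow> nat \<Rightarrow> quat mat" where
  "qsvd_truncation m n U \<sigma> V K = U * sigma_mat m n (\<lambda>i. if i \<le> K then \<sigma> i else 0) * V\<^sup>H"


section \<open>The CoR-QURV algorithm\<close>

definition thin_qr :: "nat \<Rightarrow> nat \<Rightarrow> quat mat \<Rightarrow> quat mat \<Rightarrow> quat mat \<Rightarrow> bool" where
  "thin_qr m l Y Q R \<longleftrightarrow>
     orthonormal_cols m l Q \<and> R \<in> carrier_mat l l \<and> upper_triangular R \<and> Y = Q * R"

definition permutation_mat :: "nat \<Rightarrow> quat mat \<Rightarrow> bool" where
  "permutation_mat l Pm \<longleftrightarrow>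
     (\<exists>\<pi>. \<pi> permutes {..<l} \<and> Pm = mat l l (\<lambda>(i, j). if i = \<pi> j then 1 else 0))"

text \<open>No pivoting rule is imposed: every column permutation is admitted, so in particular
  those chosen by any pivoting strategy.\<close>

definition column_permuted_qr ::
  "nat \<Rightarrow> quat mat \<Rightarrow> quat mat \<Rightarrow> quat mat \<Rightarrow> quat mat \<Rightarrow> bool" where
  "column_permuted_qr l M Q R Pm \<longleftrightarrow>
     unitary_quat_mat l Q \<and> R \<in> carrier_mat l l \<and> upper_triangular R \<and>
     permutation_mat l Pm \<and> M = Q * R * transpose_mat Pm"

primrec cor_Y :: "quat mat \<Rightarrow> quat mat \<Rightarrow> nat \<Rightarrow> quat mat" where
  "cor_Y A \<Omega> 0 = A * \<Omega>"
| "cor_Y A \<Omega> (Suc i) = A * (A\<^sup>H * cor_Y A \<Omega> i)"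

text \<open>Only meaningful for \<open>i \<ge> 1\<close>.\<close>

definition cor_Yhat :: "quat mat \<Rightarrow> quat mat \<Rightarrow> nat \<Rightarrow> quat mat" where
  "cor_Yhat A \<Omega> i = A\<^sup>H * cor_Y A \<Omega> (i - 1)"

text \<open>The factorizations are not unique, so a run of the algorithm is a relation between
  the input and the computed factors.\<close>

definition cor_qurv_run ::
  "nat \<Rightarrow> nat \<Rightarrow> nat \<Rightarrow> nat \<Rightarrow> quat mat \<Rightarrow> quat mat \<Rightarrow> quat mat \<Rightarrow> quat mat \<Rightarrow> quat mat \<Rightarrow>
     quat mat \<Rightarrow> quat mat \<Rightarrow> quat mat \<Rightarrow> quat mat \<Rightarrow> bool" where
  "cor_qurv_run m n l p A \<Omega> Q1 R1 Q2 R2 Q3 R3 Pm \<longleftrightarrow>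
     thin_qr m l (cor_Y A \<Omega> p) Q1 R1 \<and>
     thin_qr n l (cor_Yhat A \<Omega> p) Q2 R2 \<and>
     column_permuted_qr l (Q1\<^sup>H * A * Q2) Q3 R3 Pm"

definition cor_approx :: "quat mat \<Rightarrow> quat mat \<Rightarrow> quat mat \<Rightarrow> quat mat" where
  "cor_approx A Q1 Q2 = Q1 * Q1\<^sup>H * A * Q2 * Q2\<^sup>H"

lemma permutation_mat_H:
  assumes "permutation_mat l Pm"
  shows "Pm\<^sup>H = transpose_mat Pm"
  using assms by (auto simp: permutation_mat_def mat_H_def qcnj_def quat_ops intro!: eq_matI)

text \<open>The product of the computed factors is \<^const>\<open>cor_approx\<close>.\<close>

lemma cor_qurv_run_approx:
  assumes "A \<in> carrier_mat m n" "cor_qurv_run m n l p A \<Omega> Q1 R1 Q2 R2 Q3 R3 Pm"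
  shows "(Q1 * Q3) * R3 * (Q2 * Pm)\<^sup>H = cor_approx A Q1 Q2"
proof -
  have c: "Q1 \<in> carrier_mat m l" "Q2 \<in> carrier_mat n l" "Q3 \<in> carrier_mat l l"
      "R3 \<in> carrier_mat l l" "Pm \<in> carrier_mat l l"
    and M: "Q1\<^sup>H * A * Q2 = Q3 * R3 * transpose_mat Pm" and Pm: "Pm\<^sup>H = transpose_mat Pm"
    using assms(2) permutation_mat_H
    by (auto simp: cor_qurv_run_def thin_qr_def orthonormal_cols_def column_permuted_qr_def
        unitary_quat_mat_def permutation_mat_def)
  have c': "Q1\<^sup>H \<in> carrier_mat l m" "Q2\<^sup>H \<in> carrier_mat l n" "transpose_mat Pm \<in> carrier_mat l l"
    using c mat_H_carrier by auto
  have "(Q1 * Q3) * R3 * (Q2 * Pm)\<^sup>H = (Q1 * Q3) * R3 * (transpose_mat Pm * Q2\<^sup>H)"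
    using c by (simp add: mat_H_mult Pm)
  also have "\<dots> = (Q1 * Q3) * (R3 * (transpose_mat Pm * Q2\<^sup>H))"
    using c c' by (intro assoc_mult_mat) auto
  also have "\<dots> = Q1 * (Q3 * (R3 * (transpose_mat Pm * Q2\<^sup>H)))"
    using c c' by (intro assoc_mult_mat) auto
  also have "Q3 * (R3 * (transpose_mat Pm * Q2\<^sup>H)) = Q3 * R3 * (transpose_mat Pm * Q2\<^sup>H)"
    using c c' by (intro assoc_mult_mat[symmetric]) auto
  also have "\<dots> = Q3 * R3 * transpose_mat Pm * Q2\<^sup>H"
    using c c' by (intro assoc_mult_mat[symmetric, of _ l l _ l _ n]) auto
  also have "\<dots> = Q1\<^sup>H * A * Q2 * Q2\<^sup>H"
    by (simp add: M)
  also have "Q1 * \<dots> = Q1 * (Q1\<^sup>H * A * Q2) * Q2\<^sup>H"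
    using c c' assms(1) by (intro assoc_mult_mat[symmetric, of _ m l _ l _ n]) auto
  also have "Q1 * (Q1\<^sup>H * A * Q2) = Q1 * (Q1\<^sup>H * A) * Q2"
    using c c' assms(1) by (intro assoc_mult_mat[symmetric, of _ m l _ n _ l]) auto
  also have "Q1 * (Q1\<^sup>H * A) = Q1 * Q1\<^sup>H * A"
    using c c' assms(1) by (intro assoc_mult_mat[symmetric, of _ m l _ m _ n]) auto
  finally show ?thesis
    by (simp add: cor_approx_def)
qed

text \<open>\<open>W 0, \<dots>, W (q - 1)\<close> are random \<open>n \<times> l\<close> matrices whose entries, taken over all
  \<open>q\<close> matrices together, are independent standard normal variables.\<close>

definition indep_std_normal_mats ::
  "'w measure \<Rightarrow> nat \<Rightarrow> nat \<Rightarrow> (nat \<Rightarrow> 'w \<Rightarrow> real mat) \<Rightarrow> nat \<Rightarrow> bool" where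
  "indep_std_normal_mats S n l W q \<longleftrightarrow>
     (\<forall>c<q. \<forall>\<omega>\<in>space S. W c \<omega> \<in> carrier_mat n l) \<and>
     (\<forall>c<q. \<forall>i<n. \<forall>j<l. distributed S lborel (\<lambda>\<omega>. W c \<omega> $$ (i, j)) std_normal_density) \<and>
     prob_space.indep_vars S (\<lambda>_. borel) (\<lambda>(c, i, j) \<omega>. W c \<omega> $$ (i, j))
       ({..<q} \<times> {..<n} \<times> {..<l})"

end

(*
  Write A_K for the truncated QSVD and A_0 = A - A_K. Two-sided orthogonal projection does not
  increase the Frobenius norm of A_0, so the error is at most |A_0| plus the residuals of A_K under
  the left and the right projection. Let Z = V^H Omega and L = l - P. For every x_k with
  (Z x_k)_i = delta_ik for i < L, the vector Y_p x_k lies in the range of Q_1 and, after rescaling,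
  differs from the left singular vector u_k only in the directions i >= L; the residuals are
  therefore controlled by sigma_(L+1) gamma_K times the norms of (Z x_k)_(i >= L).

  Z is again a standard normal quaternion matrix, by rotation invariance. Given the rows i < L other
  than k, choose P + 1 orthonormal vectors e_t annihilated by them, put z_t = Z_k e_t and let x_k be
  the average of e_t / z_t. Independence of the rows i >= L then gives
  E |(Z x_k)_(i >= L)|^2 = 4 (N - L) E |x_k|^2 with E |x_k|^2 = O(1 / (P + 1)), because
  E 1/|z_t|^2 is finite for a standard normal quaternion; the constant nu leaves ample room.
  The choice of x_k need not be measurable: the error is bounded by an infimum over rational vectors,
  and only this infimum is integrated.
*)
theory Submission
  imports Defs
begin

section \<open>Quaternion matrices and orthogonal projections\<close>

text \<open>Second moments are estimated and Jensen's inequality returns to the expectation; summing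
  the same second-moment bound over the \<open>K\<close> columns produces \<open>sqrt K\<close>. The
  obstacle is \<open>P = 0\<close>, where there is nothing to average and \<open>E 1/|z|^2\<close>
  itself must be finite. For a real Gaussian it is infinite; a quaternion has four real components,
  and AM-GM bounds \<open>1/|z|^2\<close> by a product of four integrable factors
  \<open>|z_c|^(-1/2)\<close>. Averaging gains one factor \<open>1/(P + 1)\<close> in the second
  moment, whereas \<open>\<nu>\<close> squared decays like \<open>1/(P + 1)^2\<close>. The gap is
  closed because \<open>\<nu>\<close> squared also grows like \<open>N^2\<close> and
  \<open>P + 1\<close> is at most \<open>N\<close>. The penalty vanishes at the exact solution, so
  its large coefficient, a power of \<open>\<sigma> 1 / \<sigma> K\<close>, never reaches the final
  bound.\<close>

lemma norm_quat_sq: "(norm x)\<^sup>2 = (q_re x)\<^sup>2 + (q_i x)\<^sup>2 + (q_j x)\<^sup>2 + (q_k x)\<^sup>2"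
  by (simp add: norm_quat_def)

text \<open>Euler's four-square identity.\<close>

lemma norm_mult_quat: "norm (x * y) = norm x * norm (y :: quat)"
proof (rule power2_eq_imp_eq)
  show "(norm (x * y))\<^sup>2 = (norm x * norm y)\<^sup>2"
    by (simp add: norm_quat_sq times_quat_def power_mult_distrib)
      (simp add: power2_eq_square algebra_simps)
qed simp_all

instance quat :: real_normed_algebra_1
proof
  fix a :: real and x y :: quat
  show "a *\<^sub>R x * y = a *\<^sub>R (x * y)" "x * a *\<^sub>R y = a *\<^sub>R (x * y)"
    by (simp_all add: scaleR_quat_def times_quat_def algebra_simps)
  show "norm (x * y) \<le> norm x * norm y"
    by (simp add: norm_mult_quat)
  show "norm (1 :: quat) = 1"
    by (simp add: norm_quat_def one_quat_def)
qed

lemma norm_qcnj [simp]: "norm (qcnj x) = norm x"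
  by (simp add: norm_quat_def qcnj_def)

lemma qcnj_minus: "qcnj (x - y) = qcnj x - qcnj y"
  by (simp add: qcnj_def minus_quat_def)

lemma q_re_simps [simp]:
  "q_re 0 = 0" "q_re (x + y) = q_re x + q_re y" "q_re (x - y) = q_re x - q_re y"
  by (simp_all add: quat_ops)

lemma q_re_sum: "q_re (sum f A) = (\<Sum>x\<in>A. q_re (f x))"
  by (induction A rule: infinite_finite_induct) simp_all

lemma mult_qcnj: "x * qcnj x = Quat ((norm x)\<^sup>2) 0 0 0" "qcnj x * x = Quat ((norm x)\<^sup>2) 0 0 0"
  by (simp_all add: norm_quat_sq qcnj_def times_quat_def) (simp_all add: power2_eq_square)

lemma mat_H_dim [simp]: "dim_row A\<^sup>H = dim_col A" "dim_col A\<^sup>H = dim_row A"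
  by (simp_all add: mat_H_def)

lemma mat_H_H [simp]: "A\<^sup>H\<^sup>H = A"
  by (rule eq_matI) (auto simp: mat_H_def)

lemma mat_H_minus:
  assumes "A \<in> carrier_mat m n" "B \<in> carrier_mat m n"
  shows "(A - B)\<^sup>H = A\<^sup>H - B\<^sup>H"
  using assms by (intro eq_matI) (auto simp: mat_H_def qcnj_minus)

text \<open>Through this additive functional, the isometry and Pythagoras statements for the
  Frobenius norm become identities between matrices \<open>X\<^sup>H * X\<close>.\<close>

definition re_trace :: "quat mat \<Rightarrow> real" where
  "re_trace X = (\<Sum>i<dim_row X. q_re (X $$ (i, i)))"

lemma re_trace_minus:
  assumes "A \<in> carrier_mat m m" "B \<in> carrier_mat m m"
  shows "re_trace (A - B) = re_trace A - re_trace B"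
  using assms by (simp add: re_trace_def sum_subtractf)

lemma frob_norm_nonneg [simp]: "0 \<le> frob_norm A"
  by (simp add: frob_norm_def sum_nonneg)

lemma frob_norm_sq: "(frob_norm A)\<^sup>2 = (\<Sum>i<dim_row A. \<Sum>j<dim_col A. (norm (A $$ (i, j)))\<^sup>2)"
  by (simp add: frob_norm_def sum_nonneg)

lemma frob_norm_sq_trace: "(frob_norm A)\<^sup>2 = re_trace (A\<^sup>H * A)"
proof -
  have "re_trace (A\<^sup>H * A) = (\<Sum>j<dim_col A. \<Sum>i<dim_row A. (norm (A $$ (i, j)))\<^sup>2)"
    by (simp add: re_trace_def scalar_prod_def mat_H_def q_re_sum mult_qcnj atLeast0LessThan)
  then show ?thesis
    by (subst (asm) sum.swap) (simp add: frob_norm_sq)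
qed

lemma frob_norm_mat_H [simp]: "frob_norm A\<^sup>H = frob_norm A"
  unfolding frob_norm_def by (subst sum.swap) (simp add: mat_H_def)

lemma frob_norm_triangle:
  assumes "A \<in> carrier_mat m n" "B \<in> carrier_mat m n"
  shows "frob_norm (A + B) \<le> frob_norm A + frob_norm B"
proof -
  have L: "frob_norm X = L2_set (\<lambda>p. norm (X $$ p)) ({..<m} \<times> {..<n})" if "X \<in> carrier_mat m n" for X
    using that by (simp add: frob_norm_def L2_set_def sum.cartesian_product)
  have "frob_norm (A + B) \<le> L2_set (\<lambda>p. norm (A $$ p) + norm (B $$ p)) ({..<m} \<times> {..<n})"
    using assms by (auto simp: L[of "A + B"] intro!: L2_set_mono norm_triangle_ineq)
  also have "\<dots> \<le> frob_norm A + frob_norm B"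
    using assms by (simp add: L L2_set_triangle_ineq)
  finally show ?thesis .
qed

lemma frob_norm_isometry:
  assumes Q: "orthonormal_cols m l Q" and X: "X \<in> carrier_mat l n"
  shows "frob_norm (Q * X) = frob_norm X"
proof (rule power2_eq_imp_eq)
  have c: "Q \<in> carrier_mat m l" "Q\<^sup>H \<in> carrier_mat l m" "X\<^sup>H \<in> carrier_mat n l"
    using Q X by (auto simp: orthonormal_cols_def mat_H_carrier)
  have "(Q * X)\<^sup>H * (Q * X) = X\<^sup>H * (Q\<^sup>H * (Q * X))"
    using c X by (simp add: mat_H_mult[of _ m l] assoc_mult_mat[of _ n l _ m _ n])
  also have "Q\<^sup>H * (Q * X) = Q\<^sup>H * Q * X"
    using c X by (simp add: assoc_mult_mat[of _ l m _ l _ n])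
  finally show "(frob_norm (Q * X))\<^sup>2 = (frob_norm X)\<^sup>2"
    using Q X by (simp add: frob_norm_sq_trace orthonormal_cols_def)
qed simp_all

section \<open>Orthogonal projections in the Frobenius norm\<close>

definition orth_proj_mat :: "nat \<Rightarrow> quat mat \<Rightarrow> bool" where
  "orth_proj_mat m P \<longleftrightarrow> P \<in> carrier_mat m m \<and> P\<^sup>H = P \<and> P * P = P"

lemma orth_proj_mat_cols:
  assumes "orthonormal_cols m l Q"
  shows "orth_proj_mat m (Q * Q\<^sup>H)"
proof -
  have c: "Q \<in> carrier_mat m l" "Q\<^sup>H \<in> carrier_mat l m" and 1: "Q\<^sup>H * Q = 1\<^sub>m l"
    using assms by (auto simp: orthonormal_cols_def mat_H_carrier)
  have "Q * Q\<^sup>H * (Q * Q\<^sup>H) = Q * (Q\<^sup>H * (Q * Q\<^sup>H))"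
    using c by (simp add: assoc_mult_mat[of _ m l _ m _ m])
  also have "Q\<^sup>H * (Q * Q\<^sup>H) = Q\<^sup>H"
    using c by (simp add: 1 flip: assoc_mult_mat[of _ l m _ l _ m])
  finally show ?thesis
    using c by (simp add: orth_proj_mat_def mat_H_mult[of _ m l])
qed

text \<open>As \<open>P\<close> is Hermitian and idempotent, every cross term equals
  \<open>X\<^sup>H * (P * X)\<close>, so the Gram matrices of \<open>P * X\<close> and
  \<open>X - P * X\<close> add up to \<open>X\<^sup>H * X\<close>.\<close>

lemma frob_norm_pythagoras:
  assumes P: "orth_proj_mat m P" and X: "X \<in> carrier_mat m n"
  shows "(frob_norm (X - P * X))\<^sup>2 + (frob_norm (P * X))\<^sup>2 = (frob_norm X)\<^sup>2"
proof -
  have c: "P \<in> carrier_mat m m" "X\<^sup>H \<in> carrier_mat n m" "P * X \<in> carrier_mat m n"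
    using P X by (auto simp: orth_proj_mat_def mat_H_carrier)
  have PPX: "P * (P * X) = P * X"
    using P X by (simp add: orth_proj_mat_def flip: assoc_mult_mat[of _ m m _ m _ n])
  have H: "(P * X)\<^sup>H = X\<^sup>H * P"
    using P X by (simp add: orth_proj_mat_def mat_H_mult[of _ m m _ n])
  have 1: "(P * X)\<^sup>H * (P * X) = X\<^sup>H * (P * X)"
    using c by (simp add: H PPX assoc_mult_mat[of _ n m _ m _ n])
  have "(X - P * X)\<^sup>H * (X - P * X) = X\<^sup>H * (X - P * X) - (P * X)\<^sup>H * (X - P * X)"
    unfolding mat_H_minus[OF X c(3)]
    using c X by (intro minus_mult_distrib_mat[of _ n m]) (auto simp: mat_H_carrier)
  also have "(P * X)\<^sup>H * (X - P * X) = X\<^sup>H * (P * X - P * X)"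
  proof -
    have "X\<^sup>H * P * (X - P * X) = X\<^sup>H * (P * (X - P * X))"
      by (rule assoc_mult_mat[OF c(2,1) minus_carrier_mat[OF c(3)]])
    also have "P * (X - P * X) = P * X - P * (P * X)"
      by (rule mult_minus_distrib_mat[OF c(1) X c(3)])
    finally show ?thesis by (simp add: H PPX)
  qed
  also have "X\<^sup>H * (X - P * X) - X\<^sup>H * (P * X - P * X) = X\<^sup>H * X - X\<^sup>H * (P * X)"
    by (rule eq_matI) (use c X in \<open>simp_all add: mult_minus_distrib_mat[of _ n m] minus_r_inv_mat[of _ m n]\<close>)
  finally show ?thesis
    using c X by (simp add: frob_norm_sq_trace 1 re_trace_minus[of _ n])
qed

lemma frob_norm_proj_le:
  assumes "orth_proj_mat m P" "X \<in> carrier_mat m n"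
  shows "frob_norm (P * X) \<le> frob_norm X" "frob_norm (X - P * X) \<le> frob_norm X"
proof -
  have "(frob_norm (P * X))\<^sup>2 \<le> (frob_norm X)\<^sup>2" "(frob_norm (X - P * X))\<^sup>2 \<le> (frob_norm X)\<^sup>2"
    using frob_norm_pythagoras[OF assms] zero_le_power2[of "frob_norm (P * X)"]
      zero_le_power2[of "frob_norm (X - P * X)"] by linarith+
  then show "frob_norm (P * X) \<le> frob_norm X" "frob_norm (X - P * X) \<le> frob_norm X"
    by (auto intro: power2_le_imp_le)
qed

lemma mat_minus_cancel:
  fixes A B C :: "'a :: ab_group_add mat"
  assumes "A \<in> carrier_mat m n" "B \<in> carrier_mat m n" "C \<in> carrier_mat m n"
  shows "A - C - (B - C) = A - B" "A - B + (B - C) = A - C"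
proof -
  note d = assms[THEN carrier_matD(1)] assms[THEN carrier_matD(2)]
  show "A - C - (B - C) = A - B"
    by (rule eq_matI) (simp_all add: d)
  show "A - B + (B - C) = A - C"
    by (rule eq_matI) (simp_all add: d)
qed

text \<open>\<open>P\<close> fixes \<open>T\<close>, so \<open>X - T\<close> and \<open>X\<close>
  have the same residual, and a residual is never longer than the matrix itself. Any explicit
  \<open>T\<close> with columns in the range of \<open>P\<close> can therefore serve as a
  competitor.\<close>

lemma frob_norm_proj_best:
  assumes P: "orth_proj_mat m P" and X: "X \<in> carrier_mat m n" and T: "T \<in> carrier_mat m n" "P * T = T"
  shows "frob_norm (X - P * X) \<le> frob_norm (X - T)"
proof -
  have c: "P \<in> carrier_mat m m" using P by (simp add: orth_proj_mat_def)
  have "X - T - P * (X - T) = X - P * X"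
    using mult_minus_distrib_mat[OF c X T(1)] mat_minus_cancel(1)[OF X mult_carrier_mat[OF c X] T(1)]
    by (simp only: T(2))
  then show ?thesis
    using frob_norm_proj_le(2)[OF P minus_carrier_mat[OF T(1)], of X] by simp
qed

text \<open>Both bounds use the splitting \<open>X - P1 X P2 = (X - P1 X) + P1 (X - X P2)\<close>.
  Its summands are orthogonal, which gives the contraction with constant 1; the triangle inequality
  gives the second bound.\<close>

lemma frob_norm_two_sided_le:
  assumes P1: "orth_proj_mat m P1" and P2: "orth_proj_mat n P2" and X: "X \<in> carrier_mat m n"
  shows "frob_norm (X - P1 * X * P2) \<le> frob_norm X"
    and "frob_norm (X - P1 * X * P2) \<le> frob_norm (X - P1 * X) + frob_norm (X\<^sup>H - P2 * X\<^sup>H)"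
proof -
  have c: "P1 \<in> carrier_mat m m" "P2 \<in> carrier_mat n n" "P1 * P1 = P1"
    using P1 P2 by (simp_all add: orth_proj_mat_def)
  \<comment> \<open>Conjugate transposition turns a projection acting from the right into one acting
    from the left.\<close>
  have right: "frob_norm (Y - Y * P2) = frob_norm (Y\<^sup>H - P2 * Y\<^sup>H)" if "Y \<in> carrier_mat m n" for Y
  proof -
    have "(Y - Y * P2)\<^sup>H = Y\<^sup>H - P2 * Y\<^sup>H"
      using that P2 c by (simp add: orth_proj_mat_def mat_H_minus[of _ m n] mat_H_mult[of _ m n])
    then show ?thesis by (metis frob_norm_mat_H)
  qed
  let ?D = "X - P1 * X * P2"
  have XP: "P1 * X * P2 = P1 * (X * P2)"
    using c X by (intro assoc_mult_mat[of _ m m _ n _ n]) auto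
  have "P1 * (P1 * (X * P2)) = P1 * P1 * (X * P2)"
    using c X by (intro assoc_mult_mat[of _ m m _ m _ n, symmetric]) auto
  then have PXP: "P1 * (P1 * X * P2) = P1 * X * P2"
    by (simp add: XP c(3))
  have "P1 * ?D = P1 * X - P1 * (P1 * X * P2)"
    using c X by (intro mult_minus_distrib_mat[of _ m m _ n]) auto
  then have PD: "P1 * ?D = P1 * X - P1 * X * P2"
    by (simp only: PXP)
  have D: "?D - P1 * ?D = X - P1 * X"
    unfolding PD using c(1,2) X by (intro mat_minus_cancel(1)[of _ m n]) auto
  have "(frob_norm ?D)\<^sup>2 = (frob_norm (X - P1 * X))\<^sup>2 + (frob_norm (P1 * X - P1 * X * P2))\<^sup>2"
    using frob_norm_pythagoras[OF P1, of ?D n] c(1,2) X D PD minus_carrier_mat[of "P1 * X * P2" m n X] by simp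
  also have "frob_norm (P1 * X - P1 * X * P2) \<le> frob_norm (P1 * X)"
    unfolding right[OF mult_carrier_mat[OF c(1) X]]
    using frob_norm_proj_le(2)[OF P2, of "(P1 * X)\<^sup>H" m] c X by (simp add: mat_H_carrier)
  then have "(frob_norm (P1 * X - P1 * X * P2))\<^sup>2 \<le> (frob_norm (P1 * X))\<^sup>2"
    by (simp add: power_mono)
  finally have "(frob_norm ?D)\<^sup>2 \<le> (frob_norm X)\<^sup>2"
    using frob_norm_pythagoras[OF P1 X] by simp
  then show "frob_norm ?D \<le> frob_norm X"
    by (rule power2_le_imp_le) simp
  have "P1 * X - P1 * X * P2 = P1 * (X - X * P2)"
    unfolding XP using c(1,2) X by (intro mult_minus_distrib_mat[of _ m m _ n, symmetric]) auto
  moreover have "?D = (X - P1 * X) + (P1 * X - P1 * X * P2)"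
    using c(1,2) X by (intro mat_minus_cancel(2)[of _ m n, symmetric]) auto
  ultimately have "frob_norm ?D \<le> frob_norm (X - P1 * X) + frob_norm (P1 * (X - X * P2))"
    using frob_norm_triangle[OF minus_carrier_mat[OF mult_carrier_mat[OF c(1) X], of X]
        mult_carrier_mat[OF c(1) minus_carrier_mat[OF mult_carrier_mat[OF X c(2)], of X]]] by simp
  also have "frob_norm (P1 * (X - X * P2)) \<le> frob_norm (X - X * P2)"
    using c X by (intro frob_norm_proj_le(1)[OF P1]) auto
  finally show "frob_norm ?D \<le> frob_norm (X - P1 * X) + frob_norm (X\<^sup>H - P2 * X\<^sup>H)"
    by (simp add: right[OF X])
qed

section \<open>Residuals in singular coordinates\<close>

lemma orthonormal_cols_unitary: "unitary_quat_mat m U \<Longrightarrow> orthonormal_cols m m U"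
  by (simp add: unitary_quat_mat_def orthonormal_cols_def)

text \<open>\<open>U * B * C = Q * (R * C)\<close> is fixed by the projection, so it competes with
  \<open>U * S\<close> for every coefficient matrix \<open>C\<close>. The unitary factors preserve
  the norm and drop out, leaving a comparison of the diagonal \<open>S\<close> with
  \<open>B * C\<close>.\<close>

lemma frob_norm_svd_residual:
  assumes U: "unitary_quat_mat m U" and V: "unitary_quat_mat n V" and S: "S \<in> carrier_mat m n"
    and Q: "orthonormal_cols m l Q" and R: "R \<in> carrier_mat l l" and B: "B \<in> carrier_mat m l"
    and QR: "U * B = Q * R" and C: "C \<in> carrier_mat l n"
  shows "frob_norm (U * S * V\<^sup>H - Q * Q\<^sup>H * (U * S * V\<^sup>H)) \<le> frob_norm (S - B * C)"
proof -
  let ?P = "Q * Q\<^sup>H"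
  have P: "orth_proj_mat m ?P" by (rule orth_proj_mat_cols[OF Q])
  have cU: "U \<in> carrier_mat m m" and cV: "V \<in> carrier_mat n n" "V\<^sup>H \<in> carrier_mat n n"
    and cQ: "Q \<in> carrier_mat m l" "Q\<^sup>H \<in> carrier_mat l m" "Q\<^sup>H * Q = 1\<^sub>m l"
    using U V Q by (auto simp: unitary_quat_mat_def orthonormal_cols_def mat_H_carrier)
  have cP: "?P \<in> carrier_mat m m" and US: "U * S \<in> carrier_mat m n"
    using cQ(1,2) cU S by auto
  define D where "D = U * S - ?P * (U * S)"
  have cD: "D \<in> carrier_mat m n"
    unfolding D_def using mult_carrier_mat[OF cP US] by (rule minus_carrier_mat)
  have "U * S * V\<^sup>H - ?P * (U * S * V\<^sup>H) = U * S * V\<^sup>H - ?P * (U * S) * V\<^sup>H"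
    by (simp only: assoc_mult_mat[OF cP US cV(2)])
  also have "\<dots> = D * V\<^sup>H"
    unfolding D_def by (rule minus_mult_distrib_mat[OF US mult_carrier_mat[OF cP US] cV(2), symmetric])
  finally have "frob_norm (U * S * V\<^sup>H - ?P * (U * S * V\<^sup>H)) = frob_norm (D * V\<^sup>H)"
    by simp
  also have "(D * V\<^sup>H)\<^sup>H = V * D\<^sup>H"
    by (simp add: mat_H_mult[OF cD cV(2)])
  then have "frob_norm (D * V\<^sup>H) = frob_norm (V * D\<^sup>H)"
    by (metis frob_norm_mat_H)
  also have "\<dots> = frob_norm D"
    using frob_norm_isometry[OF orthonormal_cols_unitary[OF V] mat_H_carrier[OF cD]] by simp
  also have "\<dots> \<le> frob_norm (U * S - U * (B * C))"
    unfolding D_def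
  proof (rule frob_norm_proj_best[OF P US])
    show "U * (B * C) \<in> carrier_mat m n" using cU B C by auto
    have "U * (B * C) = U * B * C"
      by (rule assoc_mult_mat[OF cU B C, symmetric])
    also have "\<dots> = Q * (R * C)"
      unfolding QR by (rule assoc_mult_mat[OF cQ(1) R C])
    finally have T: "U * (B * C) = Q * (R * C)" .
    have RC: "R * C \<in> carrier_mat l n" using R C by auto
    have "?P * (Q * (R * C)) = Q * (Q\<^sup>H * (Q * (R * C)))"
      by (rule assoc_mult_mat[OF cQ(1,2) mult_carrier_mat[OF cQ(1) RC]])
    also have "Q\<^sup>H * (Q * (R * C)) = Q\<^sup>H * Q * (R * C)"
      by (rule assoc_mult_mat[OF cQ(2,1) RC, symmetric])
    also have "\<dots> = R * C"
      by (simp only: cQ(3) left_mult_one_mat[OF RC])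
    finally show "?P * (U * (B * C)) = U * (B * C)"
      by (simp only: T)
  qed
  also have "U * S - U * (B * C) = U * (S - B * C)"
    by (rule mult_minus_distrib_mat[OF cU S mult_carrier_mat[OF B C], symmetric])
  also have "frob_norm \<dots> = frob_norm (S - B * C)"
    using B C by (intro frob_norm_isometry[OF orthonormal_cols_unitary[OF U]]) auto
  finally show ?thesis .
qed

lemma sigma_mat_carrier [simp]: "sigma_mat m n \<sigma> \<in> carrier_mat m n"
  by (simp add: sigma_mat_def)

lemma mat_H_sigma_mat: "(sigma_mat m n \<sigma>)\<^sup>H = sigma_mat n m \<sigma>"
  by (rule eq_matI) (auto simp: mat_H_def sigma_mat_def qcnj_def zero_quat_def)

lemma Quat_real_mult: "Quat r 0 0 0 * x = r *\<^sub>R x"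
  by (simp add: times_quat_def scaleR_quat_def)

lemma sigma_mat_mult_index:
  assumes "X \<in> carrier_mat n k" "i < m" "j < k"
  shows "(sigma_mat m n \<sigma> * X) $$ (i, j) = (if i < n then \<sigma> (i + 1) *\<^sub>R X $$ (i, j) else 0)"
proof -
  have "(sigma_mat m n \<sigma> * X) $$ (i, j)
      = (\<Sum>t<n. (if i = t then Quat (\<sigma> (i + 1)) 0 0 0 else 0) * X $$ (t, j))"
    using assms by (simp add: sigma_mat_def scalar_prod_def atLeast0LessThan)
  also have "\<dots> = (\<Sum>t<n. if t = i then \<sigma> (i + 1) *\<^sub>R X $$ (i, j) else 0)"
    by (intro sum.cong) (auto simp: Quat_real_mult)
  finally show ?thesis
    by simp
qed

text \<open>Diagonal entries beyond the inner dimension \<open>n\<close> get lost in the product;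
  the hypothesis makes them zero on the right as well.\<close>

lemma sigma_mat_mult_sigma_mat:
  assumes "\<And>i. n < i \<Longrightarrow> \<alpha> i * \<beta> i = 0"
  shows "sigma_mat m n \<alpha> * sigma_mat n k \<beta> = sigma_mat m k (\<lambda>i. \<alpha> i * \<beta> i)"
proof (rule eq_matI)
  fix i j assume "i < dim_row (sigma_mat m k (\<lambda>i. \<alpha> i * \<beta> i))" "j < dim_col (sigma_mat m k (\<lambda>i. \<alpha> i * \<beta> i))"
  then have ij: "i < m" "j < k"
    by (simp_all add: sigma_mat_def)
  then show "(sigma_mat m n \<alpha> * sigma_mat n k \<beta>) $$ (i, j) = sigma_mat m k (\<lambda>i. \<alpha> i * \<beta> i) $$ (i, j)"
    using assms[of "Suc i"]
    by (subst sigma_mat_mult_index[of _ n k])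
      (auto simp: sigma_mat_def scaleR_quat_def zero_quat_def)
qed (simp_all add: sigma_mat_def)

text \<open>The inner unitary factors cancel, so in singular coordinates every multiplication by
  \<open>A\<close> or \<open>A\<^sup>H\<close> contributes one factor \<open>\<sigma> i\<close>. The
  alternating rectangular shapes lose nothing because \<open>\<sigma>\<close> vanishes beyond
  \<open>min m n\<close>.\<close>

lemma cor_Y_svd:
  assumes svd: "is_qsvd m n A U \<sigma> V" and Om: "\<Omega> \<in> carrier_mat n l"
  shows "cor_Y A \<Omega> p = U * (sigma_mat m n (\<lambda>i. \<sigma> i ^ (2 * p + 1)) * (V\<^sup>H * \<Omega>))"
    and "cor_Yhat A \<Omega> (Suc p) = V * (sigma_mat n n (\<lambda>i. \<sigma> i ^ (2 * p + 2)) * (V\<^sup>H * \<Omega>))"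
proof -
  have cU: "U \<in> carrier_mat m m" "U\<^sup>H \<in> carrier_mat m m" "U\<^sup>H * U = 1\<^sub>m m"
    and cV: "V \<in> carrier_mat n n" "V\<^sup>H \<in> carrier_mat n n" "V\<^sup>H * V = 1\<^sub>m n"
    and A: "A = U * sigma_mat m n \<sigma> * V\<^sup>H" and z: "\<And>i. min m n < i \<Longrightarrow> \<sigma> i = 0"
    using svd by (auto simp: is_qsvd_def unitary_quat_mat_def mat_H_carrier)
  define Z where "Z = V\<^sup>H * \<Omega>"
  have cZ: "Z \<in> carrier_mat n l" using cV Om by (simp add: Z_def)
  \<comment> \<open>The sizes are generic because this is applied to \<open>A\<close> and to
    \<open>A\<^sup>H\<close>.\<close>
  have svd_mult: "U' * sigma_mat m' n' \<sigma> * V'\<^sup>H * (V' * X) = U' * (sigma_mat m' n' \<sigma> * X)"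
    if c: "U' \<in> carrier_mat m' m'" "V' \<in> carrier_mat n' n'" "V'\<^sup>H * V' = 1\<^sub>m n'" "X \<in> carrier_mat n' l"
    for U' V' X m' n'
  proof -
    have US: "U' * sigma_mat m' n' \<sigma> \<in> carrier_mat m' n'" and cV': "V'\<^sup>H \<in> carrier_mat n' n'"
      using c by (auto simp: mat_H_carrier)
    have "U' * sigma_mat m' n' \<sigma> * V'\<^sup>H * (V' * X) = U' * sigma_mat m' n' \<sigma> * (V'\<^sup>H * (V' * X))"
      by (rule assoc_mult_mat[OF US cV' mult_carrier_mat[OF c(2,4)]])
    also have "V'\<^sup>H * (V' * X) = V'\<^sup>H * V' * X"
      by (rule assoc_mult_mat[OF cV' c(2,4), symmetric])
    also have "\<dots> = X" using c by simp
    also have "U' * sigma_mat m' n' \<sigma> * X = U' * (sigma_mat m' n' \<sigma> * X)"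
      by (rule assoc_mult_mat[OF c(1) sigma_mat_carrier c(4)])
    finally show ?thesis .
  qed
  have AH: "A\<^sup>H = V * sigma_mat n m \<sigma> * U\<^sup>H"
  proof -
    have "A\<^sup>H = V * (sigma_mat n m \<sigma> * U\<^sup>H)"
      unfolding A by (simp add: mat_H_mult[OF mult_carrier_mat[OF cU(1) sigma_mat_carrier] cV(2)]
          mat_H_mult[OF cU(1) sigma_mat_carrier] mat_H_sigma_mat)
    then show ?thesis
      by (simp add: assoc_mult_mat[OF cV(1) sigma_mat_carrier cU(2)])
  qed
  have sm: "sigma_mat m' n' \<sigma> * (sigma_mat n' n \<tau> * Z) = sigma_mat m' n (\<lambda>i. \<sigma> i * \<tau> i) * Z"
    if "{m', n'} = {m, n}" for m' n' \<tau>
  proof -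
    have "sigma_mat m' n' \<sigma> * (sigma_mat n' n \<tau> * Z) = sigma_mat m' n' \<sigma> * sigma_mat n' n \<tau> * Z"
      by (rule assoc_mult_mat[OF sigma_mat_carrier sigma_mat_carrier cZ, symmetric])
    also have "sigma_mat m' n' \<sigma> * sigma_mat n' n \<tau> = sigma_mat m' n (\<lambda>i. \<sigma> i * \<tau> i)"
      using that z by (intro sigma_mat_mult_sigma_mat) (auto simp: doubleton_eq_iff)
    finally show ?thesis .
  qed
  have AX: "A * (V * (sigma_mat n n \<tau> * Z)) = U * (sigma_mat m n (\<lambda>i. \<sigma> i * \<tau> i) * Z)" for \<tau>
  proof -
    have "A * (V * (sigma_mat n n \<tau> * Z)) = U * (sigma_mat m n \<sigma> * (sigma_mat n n \<tau> * Z))"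
      unfolding A using cU cV cZ by (intro svd_mult) (auto intro: mult_carrier_mat[OF sigma_mat_carrier])
    then show ?thesis by (simp add: sm)
  qed
  have AHX: "A\<^sup>H * (U * (sigma_mat m n \<tau> * Z)) = V * (sigma_mat n n (\<lambda>i. \<sigma> i * \<tau> i) * Z)" for \<tau>
  proof -
    have "A\<^sup>H * (U * (sigma_mat m n \<tau> * Z)) = V * (sigma_mat n m \<sigma> * (sigma_mat m n \<tau> * Z))"
      unfolding AH using cU cV cZ by (intro svd_mult) (auto intro: mult_carrier_mat[OF sigma_mat_carrier])
    then show ?thesis by (simp add: sm insert_commute)
  qed
  have VZ: "V * Z = \<Omega>"
  proof -
    have "V * Z = V * V\<^sup>H * \<Omega>"
      unfolding Z_def by (rule assoc_mult_mat[OF cV(1,2) Om, symmetric])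
    then show ?thesis
      using svd Om by (simp add: is_qsvd_def unitary_quat_mat_def)
  qed
  have 1: "cor_Y A \<Omega> p = U * (sigma_mat m n (\<lambda>i. \<sigma> i ^ (2 * p + 1)) * Z)" for p
  proof (induction p)
    case 0
    have "A * (V * Z) = U * (sigma_mat m n \<sigma> * Z)"
      unfolding A using cU cV cZ by (intro svd_mult)
    then show ?case by (simp add: VZ)
  next
    case (Suc p)
    then show ?case by (simp only: cor_Y.simps AHX AX) simp
  qed
  then show "cor_Y A \<Omega> p = U * (sigma_mat m n (\<lambda>i. \<sigma> i ^ (2 * p + 1)) * (V\<^sup>H * \<Omega>))"
    by (simp only: Z_def)
  show "cor_Yhat A \<Omega> (Suc p) = V * (sigma_mat n n (\<lambda>i. \<sigma> i ^ (2 * p + 2)) * (V\<^sup>H * \<Omega>))"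
    by (simp only: cor_Yhat_def diff_Suc_1 1 AHX flip: Z_def) simp
qed

text \<open>For \<open>k < K\<close> and \<open>i < N\<close>, the entry \<open>(i, k)\<close> of
  the difference is \<open>\<tau> (i + 1) * d k\<close> times \<open>delta_ik - (Z x_k)_i\<close>,
  since \<open>d\<close> is chosen to reproduce the diagonal of the target. Rows before
  \<open>L\<close> measure how far \<open>x_k\<close> is from solving its equations; for later rows
  \<open>delta_ik\<close> is 0. Columns from \<open>K\<close> on are zero.\<close>

lemma frob_norm_sigma_residual:
  fixes x :: "nat \<Rightarrow> nat \<Rightarrow> quat"
  assumes Z: "Z \<in> carrier_mat N l" and K: "K \<le> m" "K \<le> n" "K \<le> L" "L \<le> N"
    and d: "\<And>k. k < K \<Longrightarrow> \<tau> (k + 1) * d k = s (k + 1)"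
    and c: "\<And>i k. i < L \<Longrightarrow> k < K \<Longrightarrow> \<bar>\<tau> (i + 1) * d k\<bar> \<le> c"
    and b: "\<And>i k. L \<le> i \<Longrightarrow> k < K \<Longrightarrow> \<bar>\<tau> (i + 1) * d k\<bar> \<le> b"
  shows "(frob_norm (sigma_mat m n (\<lambda>i. if i \<le> K then s i else 0)
      - sigma_mat m N \<tau> * Z * mat l n (\<lambda>(j, k). if k < K then d k *\<^sub>R x k j else 0)))\<^sup>2
    \<le> c\<^sup>2 * (\<Sum>k<K. \<Sum>i<L. (norm ((if i = k then 1 else 0) - (\<Sum>j<l. Z $$ (i, j) * x k j)))\<^sup>2)
      + b\<^sup>2 * (\<Sum>k<K. \<Sum>i=L..<N. (norm (\<Sum>j<l. Z $$ (i, j) * x k j))\<^sup>2)"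
    (is "(frob_norm (?S - ?B * ?C))\<^sup>2 \<le> _")
proof -
  define y where "y k i = (\<Sum>j<l. Z $$ (i, j) * x k j)" for k i
  \<comment> \<open>\<open>F k i\<close> bounds the squared entry and is 0 from row \<open>N\<close>
    on, so row sums can be taken up to \<open>m\<close> or up to \<open>N\<close>.\<close>
  define F where "F k i = (if i < L then c\<^sup>2 * (norm ((if i = k then 1 else 0) - y k i))\<^sup>2
    else if i < N then b\<^sup>2 * (norm (y k i))\<^sup>2 else 0)" for k i
  have F0: "0 \<le> F k i" for k i
    by (simp add: F_def)
  have BC: "(?B * ?C) $$ (i, k) = (if i < N \<and> k < K then (\<tau> (i + 1) * d k) *\<^sub>R y k i else 0)"
    if "i < m" "k < n" for i k
  proof -
    have "?B $$ (i, j) = (if i < N then \<tau> (i + 1) *\<^sub>R Z $$ (i, j) else 0)" if "j < l" for j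
      by (rule sigma_mat_mult_index[OF Z \<open>i < m\<close> that])
    moreover have "dim_row ?B = m" "dim_col ?B = l"
      using Z by (auto simp: sigma_mat_def)
    ultimately have "(?B * ?C) $$ (i, k) = (\<Sum>j<l. (if i < N then \<tau> (i + 1) *\<^sub>R Z $$ (i, j) else 0)
        * (if k < K then d k *\<^sub>R x k j else 0))"
      using that by (simp add: scalar_prod_def atLeast0LessThan del: index_mult_mat(1))
        (simp add: index_mult_mat(1) scalar_prod_def atLeast0LessThan)
    then show ?thesis
      by (auto simp: y_def scaleR_sum_right mult.commute)
  qed
  have S: "?S $$ (i, k) = (if i = k \<and> k < K then s (k + 1) *\<^sub>R 1 else 0)" if "i < m" "k < n" for i k
    using that by (auto simp: sigma_mat_def scaleR_quat_def one_quat_def zero_quat_def)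
  have E: "(norm ((?S - ?B * ?C) $$ (i, k)))\<^sup>2 \<le> (if k < K then F k i else 0)" if "i < m" "k < n" for i k
  proof -
    have dims: "dim_row ?B = m" "dim_col ?C = n" by (auto simp: sigma_mat_def)
    have "(?S - ?B * ?C) $$ (i, k) = ?S $$ (i, k) - (?B * ?C) $$ (i, k)"
      using that dims by (intro index_minus_mat) auto
    also have "\<dots> = (if k < K then (if i < N then
        (\<tau> (i + 1) * d k) *\<^sub>R ((if i = k then 1 else 0) - y k i) else 0) else 0)"
      unfolding S[OF that] BC[OF that] using d[of k] K that
      by (auto simp: scaleR_diff_right)
    finally have e: "(?S - ?B * ?C) $$ (i, k) = \<dots>" .
    consider "k < K" "i < L" | "k < K" "L \<le> i" "i < N" | "k \<ge> K \<or> N \<le> i" by linarith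
    then show ?thesis
    proof cases
      case 1
      have "(\<tau> (i + 1) * d k)\<^sup>2 \<le> c\<^sup>2"
        using c[OF 1(2,1)] by (metis abs_ge_zero power2_abs power_mono)
      then show ?thesis
        using 1 K unfolding e by (auto simp: F_def power_mult_distrib intro!: mult_right_mono)
    next
      case 2
      have "(\<tau> (i + 1) * d k)\<^sup>2 \<le> b\<^sup>2"
        using b[OF 2(2,1)] by (metis abs_ge_zero power2_abs power_mono)
      then show ?thesis
        using 2 K unfolding e by (auto simp: F_def power_mult_distrib intro!: mult_right_mono)
    next
      case 3
      then show ?thesis unfolding e using F0 by auto
    qed
  qed
  have "(frob_norm (?S - ?B * ?C))\<^sup>2 = (\<Sum>i<m. \<Sum>k<n. (norm ((?S - ?B * ?C) $$ (i, k)))\<^sup>2)"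
    unfolding frob_norm_sq by (simp add: sigma_mat_def)
  also have "\<dots> \<le> (\<Sum>i<m. \<Sum>k<n. if k < K then F k i else 0)"
    using E by (intro sum_mono) auto
  also have "\<dots> = (\<Sum>k<n. if k < K then \<Sum>i<m. F k i else 0)"
    by (subst sum.swap) (intro sum.cong, auto)
  also have "\<dots> = (\<Sum>k<K. \<Sum>i<m. F k i)"
    using K by (intro sum.mono_neutral_cong_right) auto
  \<comment> \<open>\<open>m\<close> may lie on either side of \<open>N\<close>: rows from
    \<open>N\<close> on contribute nothing, and rows between \<open>m\<close> and \<open>N\<close>
    only add nonnegative terms.\<close>
  also have "\<dots> \<le> (\<Sum>k<K. \<Sum>i<N. F k i)"
  proof (rule sum_mono)
    fix k
    have "(\<Sum>i<m. F k i) = (\<Sum>i\<in>{..<m} \<inter> {..<N}. F k i)"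
      using K by (intro sum.mono_neutral_right) (auto simp: F_def)
    also have "\<dots> \<le> (\<Sum>i<N. F k i)"
      using F0 by (intro sum_mono2) auto
    finally show "(\<Sum>i<m. F k i) \<le> (\<Sum>i<N. F k i)" .
  qed
  also have "\<dots> = (\<Sum>k<K. (\<Sum>i<L. F k i) + (\<Sum>i=L..<N. F k i))"
  proof (rule sum.cong[OF refl])
    show "(\<Sum>i<N. F k i) = (\<Sum>i<L. F k i) + (\<Sum>i=L..<N. F k i)" for k
      using K sum.atLeastLessThan_concat[of 0 L N "F k"] by (simp add: atLeast0LessThan)
  qed
  also have "\<dots> = (\<Sum>k<K. c\<^sup>2 * (\<Sum>i<L. (norm ((if i = k then 1 else 0) - y k i))\<^sup>2)
      + b\<^sup>2 * (\<Sum>i=L..<N. (norm (y k i))\<^sup>2))"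
    by (intro sum.cong arg_cong2[of _ _ _ _ "(+)"]) (auto simp: F_def sum_distrib_left)
  finally show ?thesis
    by (simp add: y_def sum.distrib sum_distrib_left)
qed

text \<open>The weight of entry \<open>(i, k)\<close> is
  \<open>\<sigma>_i (\<sigma>_i / \<sigma>_k)^e\<close>; monotonicity bounds it through
  \<open>\<sigma> K\<close> below and \<open>\<sigma> 1\<close> or \<open>\<sigma> (L + 1)\<close>
  above. The three sizes let the lemma serve both projections: the inner size \<open>N\<close> is
  the number of columns of the original matrix in either case, while \<open>m\<close> and
  \<open>n\<close> are exchanged.\<close>

lemma frob_norm_truncation_residual:
  fixes x :: "nat \<Rightarrow> nat \<Rightarrow> quat"
  assumes U: "unitary_quat_mat m U" and V: "unitary_quat_mat n V"
    and Z: "Z \<in> carrier_mat N l" and K: "1 \<le> K" "K \<le> m" "K \<le> n" "K \<le> L" "L \<le> N"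
    and dec: "\<And>i j. 1 \<le> i \<Longrightarrow> i \<le> j \<Longrightarrow> \<sigma> j \<le> \<sigma> i" and nonneg: "\<And>i. 0 \<le> \<sigma> i" and pos: "0 < \<sigma> K"
    and QR: "thin_qr m l (U * (sigma_mat m N (\<lambda>i. \<sigma> i ^ Suc e) * Z)) Q R"
  shows "frob_norm (qsvd_truncation m n U \<sigma> V K - Q * Q\<^sup>H * qsvd_truncation m n U \<sigma> V K)
    \<le> \<sigma> 1 * (\<sigma> 1 / \<sigma> K) ^ e
        * sqrt (\<Sum>k<K. \<Sum>i<L. (norm ((if i = k then 1 else 0) - (\<Sum>j<l. Z $$ (i, j) * x k j)))\<^sup>2)
      + \<sigma> (L + 1) * (\<sigma> (L + 1) / \<sigma> K) ^ e
        * sqrt (\<Sum>k<K. \<Sum>i=L..<N. (norm (\<Sum>j<l. Z $$ (i, j) * x k j))\<^sup>2)"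
    (is "_ \<le> ?c * sqrt ?S1 + ?b * sqrt ?S2")
proof -
  \<comment> \<open>Undoes the power iteration at the wanted entry: position \<open>k\<close>
    carries the singular value number \<open>k + 1\<close>.\<close>
  define d where "d k = \<sigma> (k + 1) / \<sigma> (k + 1) ^ Suc e" for k
  let ?C = "mat l n (\<lambda>(j, k). if k < K then d k *\<^sub>R x k j else 0)"
  let ?S = "sigma_mat m n (\<lambda>i. if i \<le> K then \<sigma> i else 0)"
  let ?B = "sigma_mat m N (\<lambda>i. \<sigma> i ^ Suc e) * Z"
  have sk: "\<sigma> K \<le> \<sigma> (k + 1)" "0 < \<sigma> (k + 1)" if "k < K" for k
    using dec[of "k + 1" K] that pos by auto
  have bound: "\<bar>\<sigma> (i + 1) ^ Suc e * d k\<bar> \<le> t * (t / \<sigma> K) ^ e" if "k < K" "\<sigma> (i + 1) \<le> t" for i k t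
  proof -
    have "\<sigma> (i + 1) ^ Suc e * d k = \<sigma> (i + 1) * (\<sigma> (i + 1) / \<sigma> (k + 1)) ^ e"
      using sk[OF that(1)] by (simp add: d_def power_divide)
    moreover have "\<sigma> (i + 1) / \<sigma> (k + 1) \<le> t / \<sigma> K"
      using that sk[OF that(1)] nonneg[of "i + 1"] pos by (intro frac_le) auto
    ultimately have "\<sigma> (i + 1) ^ Suc e * d k \<le> t * (t / \<sigma> K) ^ e"
      using that sk[OF that(1)] nonneg[of "i + 1"] by (simp only:) (intro mult_mono power_mono; simp)
    moreover have "0 \<le> \<sigma> (i + 1) ^ Suc e * d k"
      using nonneg by (simp add: d_def)
    ultimately show ?thesis by simp
  qed
  have cR: "R \<in> carrier_mat l l" and Q: "orthonormal_cols m l Q" and UQR: "U * ?B = Q * R"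
    using QR by (auto simp: thin_qr_def)
  have cB: "?B \<in> carrier_mat m l"
    using Z by (intro mult_carrier_mat[OF sigma_mat_carrier])
  have "frob_norm (U * ?S * V\<^sup>H - Q * Q\<^sup>H * (U * ?S * V\<^sup>H)) \<le> frob_norm (?S - ?B * ?C)"
    by (rule frob_norm_svd_residual[OF U V _ Q cR cB UQR]) auto
  also have "\<dots> \<le> ?c * sqrt ?S1 + ?b * sqrt ?S2"
  proof (rule power2_le_imp_le)
    have nn: "0 \<le> ?c" "0 \<le> ?b" "0 \<le> ?S1" "0 \<le> ?S2"
      using nonneg pos by (auto intro!: sum_nonneg)
    then show "0 \<le> ?c * sqrt ?S1 + ?b * sqrt ?S2" by simp
    have "(frob_norm (?S - ?B * ?C))\<^sup>2 \<le> ?c\<^sup>2 * ?S1 + ?b\<^sup>2 * ?S2"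
    proof (rule frob_norm_sigma_residual[OF Z K(2-5)])
      show "\<sigma> (k + 1) ^ Suc e * d k = \<sigma> (k + 1)" if "k < K" for k
        using sk[OF that] by (simp add: d_def)
      show "\<bar>\<sigma> (i + 1) ^ Suc e * d k\<bar> \<le> ?c" if "i < L" "k < K" for i k
        using that dec[of 1 "i + 1"] by (intro bound) auto
      show "\<bar>\<sigma> (i + 1) ^ Suc e * d k\<bar> \<le> ?b" if "L \<le> i" "k < K" for i k
        using that dec[of "L + 1" "i + 1"] by (intro bound) auto
    qed
    also have "\<dots> = (?c * sqrt ?S1)\<^sup>2 + (?b * sqrt ?S2)\<^sup>2"
      using nn by (simp add: power_mult_distrib)
    also have "\<dots> \<le> (?c * sqrt ?S1 + ?b * sqrt ?S2)\<^sup>2"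
      using nn by (simp add: power2_sum)
    finally show "(frob_norm (?S - ?B * ?C))\<^sup>2 \<le> \<dots>" .
  qed
  finally show ?thesis
    by (simp only: qsvd_truncation_def)
qed

section \<open>Pathwise error bounds for the approximation\<close>

lemma cor_approx_two_sided:
  assumes "A \<in> carrier_mat m n" "orthonormal_cols m l Q1" "orthonormal_cols n l' Q2"
  shows "cor_approx A Q1 Q2 = Q1 * Q1\<^sup>H * A * (Q2 * Q2\<^sup>H)"
proof -
  have c: "Q1 * Q1\<^sup>H * A \<in> carrier_mat m n" "Q2 \<in> carrier_mat n l'" "Q2\<^sup>H \<in> carrier_mat l' n"
    using assms by (auto simp: orthonormal_cols_def mat_H_carrier)
  show ?thesis
    unfolding cor_approx_def by (rule assoc_mult_mat[OF c])
qed

text \<open>A deterministic bound on the error, from which integrability of the error and of its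
  square will follow.\<close>

lemma frob_norm_cor_approx_le:
  assumes "A \<in> carrier_mat m n" "orthonormal_cols m l Q1" "orthonormal_cols n l' Q2"
  shows "frob_norm (A - cor_approx A Q1 Q2) \<le> frob_norm A"
  unfolding cor_approx_two_sided[OF assms]
  using assms by (intro frob_norm_two_sided_le(1)[of m _ n] orth_proj_mat_cols)

text \<open>Origin of the factor \<open>(1 + \<gamma>) * \<gamma>\<close>: the left sample
  \<open>cor_Y\<close> contributes \<open>\<gamma> ^ (2 * p)\<close>, at most
  \<open>\<gamma>\<^sup>2\<close>, and the right sample \<open>cor_Yhat\<close>, with one
  multiplication fewer, contributes the power \<open>2 p - 1\<close>, at most
  \<open>\<gamma>\<close>.\<close>

lemma frob_norm_cor_approx_residual:
  fixes x :: "nat \<Rightarrow> nat \<Rightarrow> quat"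
  assumes svd: "is_qsvd m n A U \<sigma> V" and Om: "\<Omega> \<in> carrier_mat n l"
    and K: "1 \<le> K" "K \<le> m" "K \<le> n" "K \<le> L" "L \<le> n" and pos: "0 < \<sigma> K" and p: "1 \<le> p"
    and QR1: "thin_qr m l (cor_Y A \<Omega> p) Q1 R1" and QR2: "thin_qr n l (cor_Yhat A \<Omega> p) Q2 R2"
  defines "\<gamma> \<equiv> \<sigma> (L + 1) / \<sigma> K" and "Z \<equiv> V\<^sup>H * \<Omega>"
  shows "frob_norm (A - cor_approx A Q1 Q2) \<le> frob_norm (A - qsvd_truncation m n U \<sigma> V K)
    + (1 + \<gamma>) * (\<sigma> 1 * (1 + (\<sigma> 1 / \<sigma> K) ^ (2 * p)) * 2
        * sqrt (\<Sum>k<K. \<Sum>i<L. (norm ((if i = k then 1 else 0) - (\<Sum>j<l. Z $$ (i, j) * x k j)))\<^sup>2)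
      + \<sigma> (L + 1) * \<gamma> * sqrt (\<Sum>k<K. \<Sum>i=L..<n. (norm (\<Sum>j<l. Z $$ (i, j) * x k j))\<^sup>2))"
    (is "_ \<le> _ + (1 + \<gamma>) * (?c * sqrt ?S1 + ?b * sqrt ?S2)")
proof -
  let ?T = "qsvd_truncation m n U \<sigma> V K"
  have A: "A \<in> carrier_mat m n" and U: "unitary_quat_mat m U" and V: "unitary_quat_mat n V"
    and dec: "\<And>i j. 1 \<le> i \<Longrightarrow> i \<le> j \<Longrightarrow> \<sigma> j \<le> \<sigma> i" and nonneg: "\<And>i. 0 \<le> \<sigma> i"
    using svd by (auto simp: is_qsvd_def)
  have Q: "orthonormal_cols m l Q1" "orthonormal_cols n l Q2"
    using QR1 QR2 by (auto simp: thin_qr_def)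
  note P = orth_proj_mat_cols[OF Q(1)] orth_proj_mat_cols[OF Q(2)]
  have cU: "U \<in> carrier_mat m m" "V \<in> carrier_mat n n" "V\<^sup>H \<in> carrier_mat n n"
    using U V by (auto simp: unitary_quat_mat_def mat_H_carrier)
  then have T: "?T \<in> carrier_mat m n" and TH: "?T\<^sup>H = qsvd_truncation n m V \<sigma> U K"
  proof -
    let ?S = "sigma_mat m n (\<lambda>i. if i \<le> K then \<sigma> i else 0)"
    have US: "U * ?S \<in> carrier_mat m n"
      by (rule mult_carrier_mat[OF cU(1) sigma_mat_carrier])
    show "?T \<in> carrier_mat m n"
      unfolding qsvd_truncation_def by (rule mult_carrier_mat[OF US cU(3)])
    have "?T\<^sup>H = V * (?S\<^sup>H * U\<^sup>H)"
      unfolding qsvd_truncation_def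
      by (simp add: mat_H_mult[OF US cU(3)] mat_H_mult[OF cU(1) sigma_mat_carrier])
    then show "?T\<^sup>H = qsvd_truncation n m V \<sigma> U K"
      unfolding qsvd_truncation_def mat_H_sigma_mat
      by (simp only: assoc_mult_mat[OF cU(2) sigma_mat_carrier mat_H_carrier[OF cU(1)]])
  qed
  have cZ: "Z \<in> carrier_mat n l" unfolding Z_def by (rule mult_carrier_mat[OF cU(3) Om])
  \<comment> \<open>The exponent \<open>2 p - 1\<close> becomes \<open>2 * p' + 1\<close>, free of
    truncated subtraction.\<close>
  obtain p' where p': "p = Suc p'" using p by (cases p) auto
  have QR1': "thin_qr m l (U * (sigma_mat m n (\<lambda>i. \<sigma> i ^ Suc (2 * p)) * Z)) Q1 R1"
    using QR1 by (simp add: cor_Y_svd(1)[OF svd Om] Z_def)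
  have QR2': "thin_qr n l (V * (sigma_mat n n (\<lambda>i. \<sigma> i ^ Suc (2 * p' + 1)) * Z)) Q2 R2"
    using QR2 unfolding p' cor_Y_svd(2)[OF svd Om] Z_def by simp
  have "0 \<le> \<gamma>" and "\<gamma> \<le> 1"
    using dec[of K "L + 1"] K nonneg pos by (auto simp: \<gamma>_def)
  have r1: "1 \<le> \<sigma> 1 / \<sigma> K"
    using dec[of 1 K] K pos by simp
  have S: "0 \<le> ?S1" "0 \<le> ?S2" by (auto intro!: sum_nonneg)
  \<comment> \<open>One constant for both exponents, \<open>2 p\<close> and \<open>2 p - 1\<close>;
    the two residuals together account for the factor 2 in \<open>?c\<close>.\<close>
  have c1: "\<sigma> 1 * (\<sigma> 1 / \<sigma> K) ^ e \<le> \<sigma> 1 * (1 + (\<sigma> 1 / \<sigma> K) ^ (2 * p))" if "e \<le> 2 * p" for e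
    using power_increasing[OF that r1] nonneg[of 1] by (intro mult_left_mono) auto
  have b1: "\<sigma> (L + 1) * \<gamma> ^ (2 * p) \<le> \<gamma> * ?b"
    using mult_left_mono[OF power_decreasing[of 2 "2 * p" \<gamma>] nonneg[of "L + 1"]]
      p \<open>0 \<le> \<gamma>\<close> \<open>\<gamma> \<le> 1\<close>
    by (simp add: power2_eq_square mult_ac)
  have b2: "\<sigma> (L + 1) * \<gamma> ^ (2 * p' + 1) \<le> ?b"
    using power_decreasing[of 1 "2 * p' + 1" \<gamma>] \<open>0 \<le> \<gamma>\<close> \<open>\<gamma> \<le> 1\<close> nonneg[of "L + 1"]
    by (simp add: mult_left_mono)
  have "frob_norm (A - cor_approx A Q1 Q2)
      = frob_norm ((A - ?T - Q1 * Q1\<^sup>H * (A - ?T) * (Q2 * Q2\<^sup>H)) + (?T - Q1 * Q1\<^sup>H * ?T * (Q2 * Q2\<^sup>H)))"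
    (is "_ = frob_norm (?D0 + ?D1)")
  proof -
    have cP: "Q1 * Q1\<^sup>H \<in> carrier_mat m m" "Q2 * Q2\<^sup>H \<in> carrier_mat n n"
      using P by (auto simp: orth_proj_mat_def)
    have "Q1 * Q1\<^sup>H * (A - ?T) * (Q2 * Q2\<^sup>H) = cor_approx A Q1 Q2 - Q1 * Q1\<^sup>H * ?T * (Q2 * Q2\<^sup>H)"
      unfolding cor_approx_two_sided[OF A Q] mult_minus_distrib_mat[OF cP(1) A T]
      by (rule minus_mult_distrib_mat[OF mult_carrier_mat[OF cP(1) A] mult_carrier_mat[OF cP(1) T] cP(2)])
    moreover define D where "D = cor_approx A Q1 Q2"
    moreover define E where "E = Q1 * Q1\<^sup>H * ?T * (Q2 * Q2\<^sup>H)"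
    ultimately have "?D0 + ?D1 = A - ?T - (D - E) + (?T - E)" by simp
    also have "\<dots> = A - D"
    proof -
      have c: "D \<in> carrier_mat m n" "E \<in> carrier_mat m n"
        unfolding D_def E_def cor_approx_two_sided[OF A Q]
        using mult_carrier_mat[OF mult_carrier_mat[OF cP(1) A] cP(2)]
          mult_carrier_mat[OF mult_carrier_mat[OF cP(1) T] cP(2)] by auto
      note d = c[THEN carrier_matD(1)] c[THEN carrier_matD(2)] carrier_matD[OF A] carrier_matD[OF T]
      show ?thesis by (rule eq_matI) (simp_all add: d)
    qed
    finally show ?thesis by (simp only: D_def)
  qed
  also have "\<dots> \<le> frob_norm ?D0 + frob_norm ?D1"
    using P by (intro frob_norm_triangle[of _ m n] minus_carrier_mat mult_carrier_mat[of _ m n _ n]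
        mult_carrier_mat[of _ m m _ n] minus_carrier_mat[OF T] T) (auto simp: orth_proj_mat_def)
  also have "frob_norm ?D0 \<le> frob_norm (A - ?T)"
    by (rule frob_norm_two_sided_le(1)[OF P minus_carrier_mat[OF T]])
  also have "frob_norm ?D1 \<le> frob_norm (?T - Q1 * Q1\<^sup>H * ?T) + frob_norm (?T\<^sup>H - Q2 * Q2\<^sup>H * ?T\<^sup>H)"
    by (rule frob_norm_two_sided_le(2)[OF P T])
  also have "frob_norm (?T - Q1 * Q1\<^sup>H * ?T)
      \<le> \<sigma> 1 * (\<sigma> 1 / \<sigma> K) ^ (2 * p) * sqrt ?S1 + \<sigma> (L + 1) * \<gamma> ^ (2 * p) * sqrt ?S2"
    unfolding \<gamma>_def by (rule frob_norm_truncation_residual[OF U V cZ K dec nonneg pos QR1'])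
  also have "frob_norm (?T\<^sup>H - Q2 * Q2\<^sup>H * ?T\<^sup>H)
      \<le> \<sigma> 1 * (\<sigma> 1 / \<sigma> K) ^ (2 * p' + 1) * sqrt ?S1 + \<sigma> (L + 1) * \<gamma> ^ (2 * p' + 1) * sqrt ?S2"
    unfolding \<gamma>_def TH
    by (rule frob_norm_truncation_residual[OF V U cZ K(1,3,2,4,5) dec nonneg pos QR2'])
  also have "\<sigma> 1 * (\<sigma> 1 / \<sigma> K) ^ (2 * p) * sqrt ?S1 + \<sigma> (L + 1) * \<gamma> ^ (2 * p) * sqrt ?S2
      + (\<sigma> 1 * (\<sigma> 1 / \<sigma> K) ^ (2 * p' + 1) * sqrt ?S1 + \<sigma> (L + 1) * \<gamma> ^ (2 * p' + 1) * sqrt ?S2)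
      \<le> ?c * sqrt ?S1 + (1 + \<gamma>) * ?b * sqrt ?S2"
  proof -
    have c: "\<sigma> 1 * (\<sigma> 1 / \<sigma> K) ^ (2 * p) + \<sigma> 1 * (\<sigma> 1 / \<sigma> K) ^ (2 * p' + 1) \<le> ?c"
      using c1[of "2 * p"] c1[of "2 * p' + 1"] p' by simp
    have b: "\<sigma> (L + 1) * \<gamma> ^ (2 * p) + \<sigma> (L + 1) * \<gamma> ^ (2 * p' + 1) \<le> (1 + \<gamma>) * ?b"
      using b1 b2 by (simp add: distrib_right)
    have "c1 * s + b1 * t + (c2 * s + b2 * t) \<le> c * s + b * t"
      if "c1 + c2 \<le> c" "b1 + b2 \<le> b" "0 \<le> s" "0 \<le> t" for c1 c2 c b1 b2 b s t :: real
      using mult_right_mono[OF that(1,3)] mult_right_mono[OF that(2,4)] by (simp add: distrib_right)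
    from this[OF c b] show ?thesis
      using S by (simp only: real_sqrt_ge_zero)
  qed
  \<comment> \<open>Enlarging this term lets \<open>1 + \<gamma>\<close> be factored out of the
    whole excess error.\<close>
  also have "?c * sqrt ?S1 \<le> (1 + \<gamma>) * (?c * sqrt ?S1)"
    using \<open>0 \<le> \<gamma>\<close> S nonneg r1 by (simp add: mult_le_cancel_right1 distrib_right)
  finally show ?thesis
    by (simp add: distrib_left mult.assoc)
qed

section \<open>Linear equations over the quaternions\<close>

definition qinv :: "quat \<Rightarrow> quat" where
  "qinv x = (1 / (norm x)\<^sup>2) *\<^sub>R qcnj x"

lemma qinv_mult:
  assumes "x \<noteq> 0"
  shows "qinv x * x = 1" "x * qinv x = 1"
  using assms by (simp_all add: qinv_def mult_qcnj) (simp_all add: scaleR_quat_def one_quat_def)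

lemma norm_qinv: "norm (qinv x) = 1 / norm x"
  by (simp add: qinv_def power2_eq_square)

text \<open>Gaussian elimination: a nonzero pivot \<open>a i j0\<close> expresses
  \<open>x j0\<close> through the other unknowns, leaving one equation and one unknown fewer.
  Noncommutativity does no harm because coefficients always stand to the left of the
  unknowns.\<close>

lemma quat_homogeneous_solution:
  fixes a :: "'i \<Rightarrow> 'j \<Rightarrow> quat"
  assumes "finite I" "finite J" "card I < card J"
  obtains x where "\<exists>j\<in>J. x j \<noteq> 0" "\<And>i. i \<in> I \<Longrightarrow> (\<Sum>j\<in>J. a i j * x j) = 0"
proof -
  have "\<exists>x. (\<exists>j\<in>J. x j \<noteq> 0) \<and> (\<forall>i\<in>I. (\<Sum>j\<in>J. a i j * x j) = 0)"
    using assms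
  proof (induction I arbitrary: a J rule: finite_induct)
    case empty
    then obtain j where "j \<in> J" by fastforce
    then show ?case by (intro exI[of _ "\<lambda>_. 1"]) (auto simp: one_quat_def zero_quat_def)
  next
    case (insert i I)
    show ?case
    proof (cases "\<forall>j\<in>J. a i j = 0")
      case True
      obtain x where "\<exists>j\<in>J. x j \<noteq> 0" "\<forall>i\<in>I. (\<Sum>j\<in>J. a i j * x j) = 0"
        using insert.IH[of J a] insert.prems insert.hyps by auto
      then show ?thesis using True by (intro exI[of _ x]) auto
    next
      case False
      then obtain j0 where j0: "j0 \<in> J" "a i j0 \<noteq> 0" by blast
      define u where "u = qinv (a i j0)"
      have u: "a i j0 * u = 1" using j0 by (simp add: u_def qinv_mult)
      let ?J = "J - {j0}" and ?a = "\<lambda>k j. a k j - a k j0 * (u * a i j)"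
      have "card I < card ?J"
        using insert.prems insert.hyps j0 by (simp add: card_Diff_singleton)
      then obtain x where x: "\<exists>j\<in>?J. x j \<noteq> 0" "\<forall>k\<in>I. (\<Sum>j\<in>?J. ?a k j * x j) = 0"
        using insert.IH[of ?J ?a] insert.prems(1) by blast
      define y where "y = x(j0 := - (\<Sum>j\<in>?J. u * a i j * x j))"
      have sum: "(\<Sum>j\<in>J. a k j * y j) = (\<Sum>j\<in>?J. ?a k j * x j)" for k
      proof -
        have "(\<Sum>j\<in>J. a k j * y j) = a k j0 * y j0 + (\<Sum>j\<in>?J. a k j * y j)"
          using insert.prems j0 by (intro sum.remove) auto
        also have "(\<Sum>j\<in>?J. a k j * y j) = (\<Sum>j\<in>?J. a k j * x j)"
          by (intro sum.cong) (auto simp: y_def)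
        also have "a k j0 * y j0 = - (\<Sum>j\<in>?J. a k j0 * (u * a i j) * x j)"
          by (simp add: y_def sum_distrib_left mult.assoc)
        finally show ?thesis
          by (simp add: sum_subtractf left_diff_distrib)
      qed
      have "?a i j = 0" for j
        using u by (simp add: mult.assoc[symmetric])
      then have "(\<Sum>j\<in>J. a i j * y j) = 0" by (simp add: sum)
      moreover have "\<exists>j\<in>J. y j \<noteq> 0" using x(1) by (auto simp: y_def)
      ultimately show ?thesis
        using x(2) sum by (intro exI[of _ y]) auto
    qed
  qed
  then show ?thesis using that by blast
qed

text \<open>Orthogonality to the vectors found so far is added to the homogeneous system. As long as
  \<open>card I + q < l\<close> it still has fewer equations than unknowns, and a nonzero solution
  is then normalised.\<close>

lemma quat_orthonormal_null_vectors:
  fixes a :: "'i \<Rightarrow> nat \<Rightarrow> quat"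
  assumes "finite I" "card I + q \<le> l"
  obtains e :: "nat \<Rightarrow> nat \<Rightarrow> quat" where
    "\<And>i t. i \<in> I \<Longrightarrow> t < q \<Longrightarrow> (\<Sum>j<l. a i j * e t j) = 0"
    "\<And>s t. s < q \<Longrightarrow> t < q \<Longrightarrow> (\<Sum>j<l. qcnj (e s j) * e t j) = (if s = t then 1 else 0)"
proof -
  have "\<exists>e :: nat \<Rightarrow> nat \<Rightarrow> quat. (\<forall>i\<in>I. \<forall>t<q. (\<Sum>j<l. a i j * e t j) = 0)
      \<and> (\<forall>s<q. \<forall>t<q. (\<Sum>j<l. qcnj (e s j) * e t j) = (if s = t then 1 else 0))"
    using assms(2)
  proof (induction q)
    case (Suc q)
    then obtain e :: "nat \<Rightarrow> nat \<Rightarrow> quat" where "\<forall>i\<in>I. \<forall>t<q. (\<Sum>j<l. a i j * e t j) = 0"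
      "\<forall>s<q. \<forall>t<q. (\<Sum>j<l. qcnj (e s j) * e t j) = (if s = t then 1 else 0)"
      using Suc_leD[of "card I + q" l] by auto
    then have e: "\<And>i t. i \<in> I \<Longrightarrow> t < q \<Longrightarrow> (\<Sum>j<l. a i j * e t j) = 0"
      "\<And>s t. s < q \<Longrightarrow> t < q \<Longrightarrow> (\<Sum>j<l. qcnj (e s j) * e t j) = (if s = t then 1 else 0)"
      by blast+
    define b where "b k j = (case k of Inl i \<Rightarrow> a i j | Inr t \<Rightarrow> qcnj (e t j))" for k :: "'i + nat" and j
    have "card (I <+> {..<q}) < card {..<l}"
      using assms(1) Suc.prems by (simp add: card_Plus)
    then obtain x where x: "\<exists>j\<in>{..<l}. x j \<noteq> 0"
        "\<And>k. k \<in> I <+> {..<q} \<Longrightarrow> (\<Sum>j<l. b k j * x j) = 0"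
      using quat_homogeneous_solution[of "I <+> {..<q}" "{..<l}" b] assms(1) by auto
    define n where "n = (\<Sum>j<l. (norm (x j))\<^sup>2)"
    have n: "0 < n"
      unfolding n_def using x(1) by (auto intro!: sum_pos2)
    define y where "y j = (1 / sqrt n) *\<^sub>R x j" for j
    have ay: "(\<Sum>j<l. a i j * y j) = 0" if "i \<in> I" for i
      using x(2)[OF InlI[OF that]] by (simp add: b_def y_def flip: scaleR_sum_right)
    have ey: "(\<Sum>j<l. qcnj (e t j) * y j) = 0" if "t < q" for t
      using x(2)[OF InrI[of t "{..<q}" I]] that by (simp add: b_def y_def flip: scaleR_sum_right)
    have ye: "(\<Sum>j<l. qcnj (y j) * e t j) = 0" if "t < q" for t
    proof -
      have "(\<Sum>j<l. qcnj (y j) * e t j) = qcnj (\<Sum>j<l. qcnj (e t j) * y j)"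
        by (simp add: qcnj_sum qcnj_mult)
      then show ?thesis using ey[OF that] by simp
    qed
    have yy: "(\<Sum>j<l. qcnj (y j) * y j) = 1"
    proof -
      have "(norm (y j))\<^sup>2 = (norm (x j))\<^sup>2 / n" for j
        using n by (simp add: y_def power_divide)
      then have "qcnj (y j) * y j = ((norm (x j))\<^sup>2 / n) *\<^sub>R 1" for j
        unfolding mult_qcnj(2) by (simp add: scaleR_quat_def one_quat_def)
      then have "(\<Sum>j<l. qcnj (y j) * y j) = (\<Sum>j<l. (norm (x j))\<^sup>2 / n) *\<^sub>R 1"
        by (simp only: scaleR_sum_left)
      also have "(\<Sum>j<l. (norm (x j))\<^sup>2 / n) = n / n"
        by (simp only: n_def flip: sum_divide_distrib)
      finally show ?thesis using n by simp
    qed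
    show ?case
      by (intro exI[of _ "e(q := y)"]) (auto simp: less_Suc_eq e ay ey ye yy)
  qed simp
  then show ?thesis using that by blast
qed

text \<open>Parseval's identity. With coefficients on the right, \<open>qcnj (c s)\<close> and
  \<open>c t\<close> flank the inner product of \<open>e s\<close> and \<open>e t\<close>, which can
  therefore be evaluated first.\<close>

lemma sum_norm_orthonormal_combination:
  fixes e :: "nat \<Rightarrow> nat \<Rightarrow> quat"
  assumes e: "\<And>s t. s < q \<Longrightarrow> t < q \<Longrightarrow> (\<Sum>j<l. qcnj (e s j) * e t j) = (if s = t then 1 else 0)"
  shows "(\<Sum>j<l. (norm (\<Sum>t<q. e t j * c t))\<^sup>2) = (\<Sum>t<q. (norm (c t))\<^sup>2)"
proof -
  have n: "(norm x)\<^sup>2 = q_re (qcnj x * x)" for x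
    by (simp add: mult_qcnj)
  have "(\<Sum>j<l. qcnj (\<Sum>t<q. e t j * c t) * (\<Sum>t<q. e t j * c t))
      = (\<Sum>j<l. \<Sum>s<q. \<Sum>t<q. qcnj (c s) * (qcnj (e s j) * e t j) * c t)"
    by (simp add: qcnj_sum qcnj_mult sum_product mult.assoc)
  also have "\<dots> = (\<Sum>s<q. \<Sum>j<l. \<Sum>t<q. qcnj (c s) * (qcnj (e s j) * e t j) * c t)"
    by (rule sum.swap)
  also have "\<dots> = (\<Sum>s<q. \<Sum>t<q. \<Sum>j<l. qcnj (c s) * (qcnj (e s j) * e t j) * c t)"
    by (intro sum.cong refl sum.swap)
  also have "\<dots> = (\<Sum>s<q. \<Sum>t<q. qcnj (c s) * (\<Sum>j<l. qcnj (e s j) * e t j) * c t)"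
    by (simp only: sum_distrib_left sum_distrib_right)
  also have "\<dots> = (\<Sum>s<q. \<Sum>t<q. if s = t then qcnj (c t) * c t else 0)"
    by (intro sum.cong) (auto simp: e)
  also have "\<dots> = (\<Sum>t<q. qcnj (c t) * c t)"
    by simp
  finally show ?thesis
    by (simp only: n flip: q_re_sum)
qed

text \<open>The solution averages the \<open>q\<close> exact solutions \<open>e t * z\<^sub>t\<inverse>\<close> with \<open>z\<^sub>t = r \<cdot> e t\<close>; orthogonality
  then makes its squared norm smaller by a factor of \<open>q\<close> than that of a single one.\<close>

lemma quat_averaged_solution:
  fixes r :: "nat \<Rightarrow> quat" and e :: "nat \<Rightarrow> nat \<Rightarrow> quat"
  assumes q: "0 < q"
    and e: "\<And>s t. s < q \<Longrightarrow> t < q \<Longrightarrow> (\<Sum>j<l. qcnj (e s j) * e t j) = (if s = t then 1 else 0)"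
    and z: "\<And>t. t < q \<Longrightarrow> (\<Sum>j<l. r j * e t j) \<noteq> 0"
  obtains x where "(\<Sum>j<l. r j * x j) = 1"
    "\<And>a. (\<And>t. t < q \<Longrightarrow> (\<Sum>j<l. a j * e t j) = 0) \<Longrightarrow> (\<Sum>j<l. a j * x j) = 0"
    "(\<Sum>j<l. (norm (x j))\<^sup>2) = (\<Sum>t<q. 1 / (norm (\<Sum>j<l. r j * e t j))\<^sup>2) / (real q)\<^sup>2"
proof -
  define c where "c t = (1 / real q) *\<^sub>R qinv (\<Sum>j<l. r j * e t j)" for t
  define x where "x j = (\<Sum>t<q. e t j * c t)" for j
  have lin: "(\<Sum>j<l. a j * x j) = (\<Sum>t<q. (\<Sum>j<l. a j * e t j) * c t)" for a
    unfolding x_def sum_distrib_left sum_distrib_right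
    by (subst sum.swap) (simp add: mult.assoc)
  show ?thesis
  proof (rule that[of x])
    have "(\<Sum>j<l. r j * x j) = (\<Sum>t<q. (1 / real q) *\<^sub>R 1)"
      unfolding lin by (intro sum.cong) (auto simp: c_def z qinv_mult)
    then show "(\<Sum>j<l. r j * x j) = 1"
      using q by (simp add: sum_constant_scaleR del: sum_constant)
    show "(\<Sum>j<l. a j * x j) = 0" if "\<And>t. t < q \<Longrightarrow> (\<Sum>j<l. a j * e t j) = 0" for a
      unfolding lin using that by (auto intro!: sum.neutral)
    have "(\<Sum>j<l. (norm (x j))\<^sup>2) = (\<Sum>t<q. (norm (c t))\<^sup>2)"
      unfolding x_def using e by (rule sum_norm_orthonormal_combination)
    then show "(\<Sum>j<l. (norm (x j))\<^sup>2) = (\<Sum>t<q. 1 / (norm (\<Sum>j<l. r j * e t j))\<^sup>2) / (real q)\<^sup>2"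
      by (simp add: c_def norm_qinv power_mult_distrib power_divide sum_divide_distrib mult.commute)
  qed
qed

section \<open>Rotation invariance of the standard normal distribution\<close>

definition std_normal :: "real measure" where
  "std_normal = density lborel (\<lambda>x. ennreal (std_normal_density x))"

abbreviation std_normals :: "'i set \<Rightarrow> ('i \<Rightarrow> real) measure" where
  "std_normals I \<equiv> Pi\<^sub>M I (\<lambda>_. std_normal)"

lemma sets_std_normal [measurable_cong, simp]: "sets std_normal = sets borel"
  by (simp add: std_normal_def)

lemma space_std_normal [simp]: "space std_normal = UNIV"
  by (simp add: std_normal_def)

lemma sets_std_normals [measurable_cong]: "sets (std_normals I) = sets (Pi\<^sub>M I (\<lambda>_. borel))"
  by (rule sets_PiM_cong) auto

interpretation std_normal: prob_space std_normal
  unfolding std_normal_def by (rule prob_space_normal_density) simp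

interpretation std_normals: product_prob_space "\<lambda>_. std_normal" I for I
  by unfold_locales

text \<open>The Cameron-Martin formula in one dimension, by completing the square in the
  density.\<close>

lemma nn_integral_std_normal_shift:
  assumes [measurable]: "h \<in> borel_measurable borel"
  shows "(\<integral>\<^sup>+y. h (y + a) \<partial>std_normal)
    = (\<integral>\<^sup>+y. h y * ennreal (exp (a * y - a\<^sup>2 / 2)) \<partial>std_normal)"
proof -
  have e: "std_normal_density (y - a) = std_normal_density y * exp (a * y - a\<^sup>2 / 2)" for y
    by (simp add: std_normal_density_def power2_eq_square field_simps flip: exp_add)
  have "(\<integral>\<^sup>+y. h (y + a) \<partial>std_normal)
      = (\<integral>\<^sup>+y. ennreal (std_normal_density y) * h (y + a) \<partial>lborel)"
    by (simp add: std_normal_def nn_integral_density)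
  also have "\<dots> = (\<integral>\<^sup>+y. ennreal (std_normal_density (y - a)) * h y \<partial>lborel)"
    using nn_integral_real_affine[of "\<lambda>y. ennreal (std_normal_density (y - a)) * h y" 1 a]
    by (simp add: add.commute)
  also have "\<dots> = (\<integral>\<^sup>+y. h y * ennreal (exp (a * y - a\<^sup>2 / 2)) \<partial>std_normal)"
    by (simp add: std_normal_def nn_integral_density e ennreal_mult' mult_ac)
  finally show ?thesis .
qed

text \<open>The Cameron-Martin formula for a product, one coordinate at a time by Fubini.\<close>

lemma nn_integral_std_normals_shift:
  assumes "finite I" "h \<in> borel_measurable (Pi\<^sub>M I (\<lambda>_. borel))"
  shows "(\<integral>\<^sup>+x. h (\<lambda>i\<in>I. x i + a i) \<partial>std_normals I)
    = (\<integral>\<^sup>+x. h x * ennreal (exp ((\<Sum>i\<in>I. a i * x i) - (\<Sum>i\<in>I. (a i)\<^sup>2) / 2)) \<partial>std_normals I)"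
  using assms
proof (induction I arbitrary: h rule: finite_induct)
  case empty
  then show ?case
    by (simp add: PiM_empty nn_integral_count_space_finite)
next
  case (insert i I)
  note [measurable] = insert.prems and fin = insert.hyps
  let ?E = "\<lambda>x. exp ((\<Sum>i\<in>I. a i * x i) - (\<Sum>i\<in>I. (a i)\<^sup>2) / 2)"
  let ?e = "\<lambda>y. exp (a i * y - (a i)\<^sup>2 / 2)"
  define G where "G y = (\<integral>\<^sup>+x. h (x(i := y)) * ennreal (?E x) \<partial>std_normals I)" for y
  have G [measurable]: "G \<in> borel_measurable borel"
    unfolding G_def by measurable
  have r: "(\<lambda>k\<in>insert i I. (x(i := y)) k + a k) = (\<lambda>k\<in>I. x k + a k)(i := y + a i)" for x y
    using fin by (auto simp: fun_eq_iff)
  have E: "exp ((\<Sum>k\<in>insert i I. a k * (x(i := y)) k) - (\<Sum>k\<in>insert i I. (a k)\<^sup>2) / 2)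
      = ?E x * ?e y" for x y
  proof -
    have "(\<Sum>k\<in>I. a k * (x(i := y)) k) = (\<Sum>k\<in>I. a k * x k)"
      using fin by (intro sum.cong) auto
    then show ?thesis
      using fin by (simp flip: exp_add add: field_simps)
  qed
  have "(\<integral>\<^sup>+x. h (\<lambda>k\<in>insert i I. x k + a k) \<partial>std_normals (insert i I))
      = (\<integral>\<^sup>+y. (\<integral>\<^sup>+x. h ((\<lambda>k\<in>I. x k + a k)(i := y + a i)) \<partial>std_normals I) \<partial>std_normal)"
    using fin by (subst std_normals.product_nn_integral_insert_rev) (auto simp only: r, measurable)
  also have "\<dots> = (\<integral>\<^sup>+y. G (y + a i) \<partial>std_normal)"
    unfolding G_def by (intro nn_integral_cong insert.IH) measurable
  also have "\<dots> = (\<integral>\<^sup>+y. G y * ennreal (?e y) \<partial>std_normal)"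
    by (intro nn_integral_std_normal_shift G)
  also have "\<dots> = (\<integral>\<^sup>+y. (\<integral>\<^sup>+x. h (x(i := y)) * ennreal (?E x * ?e y) \<partial>std_normals I) \<partial>std_normal)"
    unfolding G_def
    by (intro nn_integral_cong, subst nn_integral_multc[symmetric])
       (measurable, simp add: ennreal_mult' mult.assoc)
  also have "\<dots> = (\<integral>\<^sup>+x. h x * ennreal (exp ((\<Sum>k\<in>insert i I. a k * x k)
      - (\<Sum>k\<in>insert i I. (a k)\<^sup>2) / 2)) \<partial>std_normals (insert i I))"
    using fin by (subst std_normals.product_nn_integral_insert_rev) (auto simp only: E, measurable)
  finally show ?case .
qed

text \<open>The map \<open>(y, x) -> (f.x, x - f (f.x - y))\<close> exchanges the component of
  \<open>x\<close> along the unit vector \<open>f\<close> with the fresh coordinate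
  \<open>y\<close>, so it is an orthogonal reflection. It factors into three shears and a sign
  change. A shear shifts one variable by an amount depending on the other, so Fubini and the shift
  formula suffice, and the exponential weights cancel in the end.\<close>

lemma nn_integral_std_normals_reflect:
  assumes I: "finite I" and f: "(\<Sum>i\<in>I. (f i)\<^sup>2) = 1"
    and [measurable]: "(\<lambda>(y, x). h y x) \<in> borel_measurable (borel \<Otimes>\<^sub>M Pi\<^sub>M I (\<lambda>_. borel))"
  shows "(\<integral>\<^sup>+x. \<integral>\<^sup>+y. h (\<Sum>i\<in>I. f i * x i) (\<lambda>i\<in>I. x i - f i * ((\<Sum>i\<in>I. f i * x i) - y))
      \<partial>std_normal \<partial>std_normals I) = (\<integral>\<^sup>+x. \<integral>\<^sup>+y. h y x \<partial>std_normal \<partial>std_normals I)"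
proof -
  interpret pair_sigma_finite "std_normals I" std_normal
    by unfold_locales
  let ?f = "\<lambda>x. \<Sum>i\<in>I. f i * x i"
  \<comment> \<open>First shear: with \<open>s = y - f.x\<close> as new variable, \<open>x\<close>
    is moved by \<open>s f\<close>, at the price of a weight.\<close>
  have "(\<integral>\<^sup>+x. \<integral>\<^sup>+y. h (?f x) (\<lambda>i\<in>I. x i - f i * (?f x - y)) \<partial>std_normal \<partial>std_normals I)
      = (\<integral>\<^sup>+x. \<integral>\<^sup>+s. h (?f x) (\<lambda>i\<in>I. x i + s * f i) * ennreal (exp (- ?f x * s - (?f x)\<^sup>2 / 2))
          \<partial>std_normal \<partial>std_normals I)"
    (is "_ = (\<integral>\<^sup>+x. \<integral>\<^sup>+s. ?g x s \<partial>_ \<partial>_)")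
  proof (rule nn_integral_cong)
    fix x assume "x \<in> space (std_normals I)"
    then have [measurable]: "x \<in> space (Pi\<^sub>M I (\<lambda>_. borel))"
      by (simp add: space_PiM)
    show "(\<integral>\<^sup>+y. h (?f x) (\<lambda>i\<in>I. x i - f i * (?f x - y)) \<partial>std_normal) = (\<integral>\<^sup>+s. ?g x s \<partial>std_normal)"
      using nn_integral_std_normal_shift[of "\<lambda>s. h (?f x) (\<lambda>i\<in>I. x i + s * f i)" "- ?f x"]
      by (simp add: algebra_simps)
  qed
  also have "\<dots> = (\<integral>\<^sup>+s. \<integral>\<^sup>+x. ?g x s \<partial>std_normals I \<partial>std_normal)"
    by (rule Fubini'[symmetric]) measurable
  also have "\<dots> = (\<integral>\<^sup>+s. \<integral>\<^sup>+x. h (?f x - s) x * ennreal (exp (?f x * s - (?f x)\<^sup>2 / 2))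
      \<partial>std_normals I \<partial>std_normal)"
  proof (rule nn_integral_cong)
    fix s :: real
    \<comment> \<open>Second shear: as \<open>f\<close> has unit length, moving \<open>x\<close> by
      \<open>s f\<close> raises \<open>f.x\<close> by \<open>s\<close>, so \<open>?h\<close>
      recovers the old value of \<open>f.x\<close> as \<open>?f x - s\<close>.\<close>
    let ?h = "\<lambda>x. h (?f x - s) x * ennreal (exp (- (?f x - s) * s - (?f x - s)\<^sup>2 / 2))"
    have f_shift: "?f (\<lambda>i\<in>I. x i + s * f i) = ?f x + s" for x
    proof -
      have "?f (\<lambda>i\<in>I. x i + s * f i) = ?f x + s * (\<Sum>i\<in>I. (f i)\<^sup>2)"
        by (simp add: algebra_simps sum.distrib sum_distrib_left power2_eq_square)
      then show ?thesis by (simp add: f)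
    qed
    have "(\<integral>\<^sup>+x. ?g x s \<partial>std_normals I) = (\<integral>\<^sup>+x. ?h (\<lambda>i\<in>I. x i + s * f i) \<partial>std_normals I)"
      by (simp only: f_shift) simp
    also have "\<dots> = (\<integral>\<^sup>+x. ?h x * ennreal (exp ((\<Sum>i\<in>I. s * f i * x i) - (\<Sum>i\<in>I. (s * f i)\<^sup>2) / 2))
        \<partial>std_normals I)"
      by (rule nn_integral_std_normals_shift[OF I]) measurable
    also have "\<dots> = (\<integral>\<^sup>+x. h (?f x - s) x * ennreal (exp (?f x * s - (?f x)\<^sup>2 / 2)) \<partial>std_normals I)"
    proof (rule nn_integral_cong)
      fix x
      have 1: "(\<Sum>i\<in>I. s * f i * x i) = s * ?f x"
        by (simp add: sum_distrib_left mult.assoc)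
      have 2: "(\<Sum>i\<in>I. (s * f i)\<^sup>2) = s\<^sup>2"
        using f by (simp add: power_mult_distrib flip: sum_distrib_left)
      have "- (?f x - s) * s - (?f x - s)\<^sup>2 / 2 + (s * ?f x - s\<^sup>2 / 2) = ?f x * s - (?f x)\<^sup>2 / 2"
        by (simp add: power2_eq_square field_simps)
      then have "exp (- (?f x - s) * s - (?f x - s)\<^sup>2 / 2) * exp (s * ?f x - s\<^sup>2 / 2)
          = exp (?f x * s - (?f x)\<^sup>2 / 2)"
        by (simp only: flip: exp_add)
      then show "?h x * ennreal (exp ((\<Sum>i\<in>I. s * f i * x i) - (\<Sum>i\<in>I. (s * f i)\<^sup>2) / 2))
          = h (?f x - s) x * ennreal (exp (?f x * s - (?f x)\<^sup>2 / 2))"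
        unfolding 1 2 by (simp only: mult.assoc flip: ennreal_mult'[OF exp_ge_zero])
    qed
    finally show "(\<integral>\<^sup>+x. ?g x s \<partial>std_normals I)
        = (\<integral>\<^sup>+x. h (?f x - s) x * ennreal (exp (?f x * s - (?f x)\<^sup>2 / 2)) \<partial>std_normals I)" .
  qed
  also have "\<dots> = (\<integral>\<^sup>+x. \<integral>\<^sup>+s. h (?f x - s) x * ennreal (exp (?f x * s - (?f x)\<^sup>2 / 2))
      \<partial>std_normal \<partial>std_normals I)"
    by (rule Fubini') measurable
  \<comment> \<open>Third shear: shifting by \<open>f.x\<close> absorbs the remaining weight and
    turns the argument into \<open>- s\<close>; the even density removes the sign.\<close>
  also have "\<dots> = (\<integral>\<^sup>+x. \<integral>\<^sup>+y. h y x \<partial>std_normal \<partial>std_normals I)"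
  proof (rule nn_integral_cong)
    fix x assume "x \<in> space (std_normals I)"
    then have [measurable]: "x \<in> space (Pi\<^sub>M I (\<lambda>_. borel))"
      by (simp add: space_PiM)
    have "(\<integral>\<^sup>+s. h (?f x - s) x * ennreal (exp (?f x * s - (?f x)\<^sup>2 / 2)) \<partial>std_normal)
        = (\<integral>\<^sup>+s. h (- s) x \<partial>std_normal)"
      using nn_integral_std_normal_shift[of "\<lambda>s. h (?f x - s) x" "?f x"] by simp
    also have "\<dots> = (\<integral>\<^sup>+s. ennreal (std_normal_density s) * h (- s) x \<partial>lborel)"
      by (simp add: std_normal_def nn_integral_density)
    also have "\<dots> = (\<integral>\<^sup>+s. ennreal (std_normal_density s) * h s x \<partial>lborel)"
      using nn_integral_real_affine[of "\<lambda>s. ennreal (std_normal_density s) * h s x" "-1" 0]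
      by (simp add: std_normal_density_def)
    also have "\<dots> = (\<integral>\<^sup>+y. h y x \<partial>std_normal)"
      by (simp add: std_normal_def nn_integral_density)
    finally show "(\<integral>\<^sup>+s. h (?f x - s) x * ennreal (exp (?f x * s - (?f x)\<^sup>2 / 2)) \<partial>std_normal)
        = (\<integral>\<^sup>+y. h y x \<partial>std_normal)" .
  qed
  finally show ?thesis .
qed

text \<open>Rotation invariance for orthonormal families of any size. In the induction the fresh
  normal coordinate \<open>y\<close> is exchanged with \<open>f j . x\<close> by the reflection;
  this leaves \<open>f k . x\<close> for \<open>k\<close> in \<open>J\<close> unchanged by
  orthogonality. Afterwards the integrand is constant in \<open>y\<close>.\<close>

lemma nn_integral_std_normals_orthonormal:
  assumes I: "finite I" and "finite J"
    and "\<And>j. j \<in> J \<Longrightarrow> (\<Sum>i\<in>I. (f j i)\<^sup>2) = 1"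
    and "\<And>j k. j \<in> J \<Longrightarrow> k \<in> J \<Longrightarrow> j \<noteq> k \<Longrightarrow> (\<Sum>i\<in>I. f j i * f k i) = 0"
    and "h \<in> borel_measurable (Pi\<^sub>M J (\<lambda>_. borel))"
  shows "(\<integral>\<^sup>+x. h (\<lambda>j\<in>J. \<Sum>i\<in>I. f j i * x i) \<partial>std_normals I) = (\<integral>\<^sup>+z. h z \<partial>std_normals J)"
  using assms(2-)
proof (induction J arbitrary: h rule: finite_induct)
  case empty
  have "emeasure (std_normals I) (space (std_normals I)) = 1"
    by (intro prob_space.emeasure_space_1 prob_space_PiM) unfold_locales
  then show ?case
    by (simp add: PiM_empty nn_integral_count_space_finite)
next
  case (insert j J)
  note [measurable] = insert.prems(3) and fin = insert.hyps
  let ?F = "\<lambda>x. \<lambda>k\<in>J. \<Sum>i\<in>I. f k i * x i" and ?f = "\<lambda>x. \<Sum>i\<in>I. f j i * x i"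
  have r: "(\<lambda>k\<in>insert j J. \<Sum>i\<in>I. f k i * x i) = (?F x)(j := ?f x)" for x
    using fin by (auto simp: fun_eq_iff)
  have F: "?F (\<lambda>i\<in>I. x i - f j i * t) = ?F x" for x t
  proof (rule restrict_ext)
    fix k assume k: "k \<in> J"
    have "(\<Sum>i\<in>I. f k i * (\<lambda>i\<in>I. x i - f j i * t) i) = (\<Sum>i\<in>I. f k i * x i) - (\<Sum>i\<in>I. f j i * f k i) * t"
      by (simp add: algebra_simps sum_subtractf sum_distrib_left)
    then show "(\<Sum>i\<in>I. f k i * (\<lambda>i\<in>I. x i - f j i * t) i) = (\<Sum>i\<in>I. f k i * x i)"
      using insert.prems(2)[of j k] k fin by auto
  qed
  have m: "(\<lambda>z. \<integral>\<^sup>+y. h (z(j := y)) \<partial>std_normal) \<in> borel_measurable (Pi\<^sub>M J (\<lambda>_. borel))"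
    by measurable
  have "(\<integral>\<^sup>+z. h z \<partial>std_normals (insert j J)) = (\<integral>\<^sup>+z. \<integral>\<^sup>+y. h (z(j := y)) \<partial>std_normal \<partial>std_normals J)"
    using fin by (intro std_normals.product_nn_integral_insert) auto
  also have "\<dots> = (\<integral>\<^sup>+x. \<integral>\<^sup>+y. h ((?F x)(j := y)) \<partial>std_normal \<partial>std_normals I)"
    using insert.prems(1,2) by (intro insert.IH[symmetric] m) auto
  also have "\<dots> = (\<integral>\<^sup>+x. \<integral>\<^sup>+y. h ((?F x)(j := ?f x)) \<partial>std_normal \<partial>std_normals I)"
    using nn_integral_std_normals_reflect[OF I, of "f j" "\<lambda>y x. h ((?F x)(j := y))"] insert.prems(1)
    by (simp only: F) simp
  also have "\<dots> = (\<integral>\<^sup>+x. h ((?F x)(j := ?f x)) \<partial>std_normals I)"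
    by (simp add: std_normal.emeasure_space_1[simplified])
  finally show ?case
    by (simp only: r)
qed

section \<open>Gaussian quaternion matrices\<close>

definition qcomp :: "nat \<Rightarrow> quat \<Rightarrow> real" where
  "qcomp c x = (if c = 0 then q_re x else if c = 1 then q_i x else if c = 2 then q_j x else q_k x)"

definition qunit :: "nat \<Rightarrow> quat" where
  "qunit c = Quat (of_bool (c = 0)) (of_bool (c = 1)) (of_bool (c = 2)) (of_bool (c = 3))"

lemma lessThan_4: "{..<4::nat} = {0, 1, 2, 3}"
  by auto

lemma norm_sq_qcomp: "(norm x)\<^sup>2 = (\<Sum>c<4. (qcomp c x)\<^sup>2)"
  by (simp add: lessThan_4 qcomp_def norm_quat_sq)

lemma qcomp_add: "qcomp c (x + y) = qcomp c x + qcomp c y"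
  by (simp add: qcomp_def plus_quat_def)

lemma qcomp_0 [simp]: "qcomp c 0 = 0"
  by (simp add: qcomp_def zero_quat_def)

lemma qcomp_sum: "qcomp c (sum f A) = (\<Sum>x\<in>A. qcomp c (f x))"
  by (induction A rule: infinite_finite_induct) (simp_all add: qcomp_add)

text \<open>Multiplication by a fixed quaternion, from either side, as a real 4 by 4 matrix.\<close>

lemma qcomp_mult:
  "qcomp c (x * y) = (\<Sum>d<4. qcomp c (x * qunit d) * qcomp d y)"
  "qcomp c (x * y) = (\<Sum>d<4. qcomp c (qunit d * y) * qcomp d x)"
  by (simp_all add: lessThan_4 qcomp_def qunit_def times_quat_def)

text \<open>Inner products of the rows of these real matrices. Summed over a unit vector or over
  columns of a unitary matrix, the factor \<open>x * qcnj y\<close> or \<open>qcnj y * x\<close>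
  becomes 1 or 0, so quaternion orthonormality turns into real orthonormality.\<close>

lemma qcomp_mult_qunit_product:
  assumes "c < 4" "c' < 4"
  shows "(\<Sum>d<4. qcomp c (x * qunit d) * qcomp c' (y * qunit d))
      = q_re (qcnj (qunit c) * (x * qcnj y) * qunit c')"
    and "(\<Sum>d<4. qcomp c (qunit d * x) * qcomp c' (qunit d * y))
      = q_re (qcnj (qunit c) * qunit c' * (qcnj y * x))"
proof -
  have "c \<in> {0, 1, 2, 3}" "c' \<in> {0, 1, 2, 3}"
    using assms by auto
  then show "(\<Sum>d<4. qcomp c (x * qunit d) * qcomp c' (y * qunit d))
      = q_re (qcnj (qunit c) * (x * qcnj y) * qunit c')"
    and "(\<Sum>d<4. qcomp c (qunit d * x) * qcomp c' (qunit d * y))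
      = q_re (qcnj (qunit c) * qunit c' * (qcnj y * x))"
    unfolding lessThan_4 insert_iff empty_iff
    by (elim disjE; simp add: qcomp_def qunit_def times_quat_def qcnj_def)+
qed

lemma q_re_qunit: "c < 4 \<Longrightarrow> c' < 4 \<Longrightarrow> q_re (qcnj (qunit c) * qunit c') = of_bool (c = c')"
  by (auto simp: qunit_def times_quat_def qcnj_def)

text \<open>The Gaussian matrix is kept as a point of a real product space with indices (component,
  row, column), so that its law is a product measure.\<close>

definition qentry :: "(nat \<times> nat \<times> nat \<Rightarrow> real) \<Rightarrow> nat \<Rightarrow> nat \<Rightarrow> quat" where
  "qentry w i j = Quat (w (0, i, j)) (w (1, i, j)) (w (2, i, j)) (w (3, i, j))"

abbreviation qindex :: "nat set \<Rightarrow> nat \<Rightarrow> (nat \<times> nat \<times> nat) set" where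
  "qindex R l \<equiv> {..<4} \<times> R \<times> {..<l}"

lemma qcomp_qentry: "d < 4 \<Longrightarrow> qcomp d (qentry w i j) = w (d, i, j)"
  by (auto simp: qcomp_def qentry_def numeral_eq_Suc less_Suc_eq)

lemma sum_qindex: "(\<Sum>p\<in>qindex R l. g p) = (\<Sum>i\<in>R. \<Sum>j<l. \<Sum>d<4. g (d, i, j))"
proof -
  have "(\<Sum>p\<in>qindex R l. g p) = (\<Sum>d<4. \<Sum>i\<in>R. \<Sum>j<l. g (d, i, j))"
    by (simp add: sum.cartesian_product)
  also have "\<dots> = (\<Sum>i\<in>R. \<Sum>d<4. \<Sum>j<l. g (d, i, j))"
    by (rule sum.swap)
  also have "\<dots> = (\<Sum>i\<in>R. \<Sum>j<l. \<Sum>d<4. g (d, i, j))"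
    by (intro sum.cong refl sum.swap)
  finally show ?thesis .
qed

text \<open>The four real components of a row times a unit vector are orthonormal linear forms in
  the entries, hence independent standard normals.\<close>

lemma nn_integral_std_normals_qrow:
  assumes R: "finite R" "i \<in> R" and e: "(\<Sum>j<l. (norm (e j))\<^sup>2) = 1"
    and h: "h \<in> borel_measurable (Pi\<^sub>M {..<4} (\<lambda>_. borel))"
  shows "(\<integral>\<^sup>+w. h (\<lambda>c\<in>{..<4}. qcomp c (\<Sum>j<l. qentry w i j * e j)) \<partial>std_normals (qindex R l))
    = (\<integral>\<^sup>+z. h z \<partial>std_normals {..<4})"
proof -
  define f where "f c p = (case p of (d, i', j) \<Rightarrow> if i' = i then qcomp c (qunit d * e j) else 0)"
    for c and p :: "nat \<times> nat \<times> nat"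
  have ff: "(\<Sum>p\<in>qindex R l. f c p * f c' p) = of_bool (c = c')" if "c < 4" "c' < 4" for c c'
  proof -
    have "(\<Sum>p\<in>qindex R l. f c p * f c' p) = (\<Sum>i'\<in>R. if i' = i then
        \<Sum>j<l. \<Sum>d<4. qcomp c (qunit d * e j) * qcomp c' (qunit d * e j) else 0)"
      unfolding sum_qindex by (intro sum.cong) (auto simp: f_def)
    also have "\<dots> = (\<Sum>j<l. q_re (qcnj (qunit c) * qunit c' * (qcnj (e j) * e j)))"
      using R that by (simp add: qcomp_mult_qunit_product(2))
    also have "\<dots> = (\<Sum>j<l. (norm (e j))\<^sup>2 * q_re (qcnj (qunit c) * qunit c'))"
      by (intro sum.cong) (simp_all add: mult_qcnj times_quat_def[of _ "Quat _ _ _ _"])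
    also have "\<dots> = of_bool (c = c')"
      using that by (simp add: e q_re_qunit flip: sum_distrib_right)
    finally show ?thesis .
  qed
  have "qcomp c (\<Sum>j<l. qentry w i j * e j) = (\<Sum>p\<in>qindex R l. f c p * w p)" if "c < 4" for c w
  proof -
    have "(\<Sum>p\<in>qindex R l. f c p * w p) = (\<Sum>i'\<in>R. if i' = i then
        \<Sum>j<l. \<Sum>d<4. qcomp c (qunit d * e j) * qcomp d (qentry w i j) else 0)"
      unfolding sum_qindex by (intro sum.cong) (auto simp: f_def qcomp_qentry)
    then show ?thesis
      using R by (simp add: qcomp_sum qcomp_mult(2)[of c "qentry _ _ _"])
  qed
  then have "(\<lambda>c\<in>{..<4}. qcomp c (\<Sum>j<l. qentry w i j * e j))
      = (\<lambda>c\<in>{..<4}. \<Sum>p\<in>qindex R l. f c p * w p)" for w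
    by (intro restrict_ext) auto
  then show ?thesis
    using nn_integral_std_normals_orthonormal[of "qindex R l" "{..<4}" f h] R h ff
    by (simp add: power2_eq_square)
qed

text \<open>Multiplying by \<open>V\<^sup>H\<close> acts on each column as a real orthogonal matrix
  of size \<open>4 n\<close>, because the columns of \<open>V\<close> are orthonormal; different
  columns involve disjoint sets of entries.\<close>

lemma nn_integral_std_normals_unitary:
  assumes V: "unitary_quat_mat n V" and h: "h \<in> borel_measurable (Pi\<^sub>M (qindex {..<n} l) (\<lambda>_. borel))"
  shows "(\<integral>\<^sup>+w. h (\<lambda>(c, i, j)\<in>qindex {..<n} l. qcomp c (\<Sum>m<n. qcnj (V $$ (m, i)) * qentry w m j))
      \<partial>std_normals (qindex {..<n} l)) = (\<integral>\<^sup>+z. h z \<partial>std_normals (qindex {..<n} l))"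
proof -
  let ?I = "qindex {..<n} l"
  define f where "f q p = (case q of (c, i, j) \<Rightarrow> case p of (d, m, j') \<Rightarrow>
      if j' = j then qcomp c (qcnj (V $$ (m, i)) * qunit d) else 0)"
    for p q :: "nat \<times> nat \<times> nat"
  have cV: "V \<in> carrier_mat n n" "V\<^sup>H * V = 1\<^sub>m n"
    using V by (auto simp: unitary_quat_mat_def)
  have VV: "(\<Sum>m<n. qcnj (V $$ (m, i)) * V $$ (m, i')) = of_bool (i = i')" if "i < n" "i' < n" for i i'
  proof -
    have "(V\<^sup>H * V) $$ (i, i') = (\<Sum>m<n. qcnj (V $$ (m, i)) * V $$ (m, i'))"
      using that cV(1) by (simp add: mat_H_def scalar_prod_def atLeast0LessThan)
    then show ?thesis using that by (cases "i = i'") (simp_all add: cV(2))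
  qed
  have ff: "(\<Sum>p\<in>?I. f q p * f q' p) = of_bool (q = q')" if "q \<in> ?I" "q' \<in> ?I" for q q'
  proof -
    obtain c i j c' i' j' where q: "q = (c, i, j)" "q' = (c', i', j')" by (metis prod_cases3)
    have lt: "c < 4" "i < n" "j < l" "c' < 4" "i' < n" "j' < l" using that by (auto simp: q)
    have "(\<Sum>p\<in>?I. f q p * f q' p) = (\<Sum>m<n. \<Sum>j''<l. if j'' = j then
        if j = j' then \<Sum>d<4. qcomp c (qcnj (V $$ (m, i)) * qunit d) * qcomp c' (qcnj (V $$ (m, i')) * qunit d)
        else 0 else 0)"
      unfolding sum_qindex by (intro sum.cong) (auto simp: f_def q)
    also have "\<dots> = (if j = j' then q_re (qcnj (qunit c) * (\<Sum>m<n. qcnj (V $$ (m, i)) * V $$ (m, i'))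
        * qunit c') else 0)"
      using lt by (simp add: qcomp_mult_qunit_product(1) sum_distrib_left sum_distrib_right q_re_sum)
    also have "\<dots> = of_bool (q = q')"
      using lt by (simp add: VV q_re_qunit q)
    finally show ?thesis .
  qed
  have "qcomp c (\<Sum>m<n. qcnj (V $$ (m, i)) * qentry w m j) = (\<Sum>p\<in>?I. f (c, i, j) p * w p)"
    if "j < l" for c i j w
  proof -
    have "(\<Sum>p\<in>?I. f (c, i, j) p * w p) = (\<Sum>m<n. \<Sum>j'<l. if j' = j then
        \<Sum>d<4. qcomp c (qcnj (V $$ (m, i)) * qunit d) * qcomp d (qentry w m j) else 0)"
      unfolding sum_qindex by (intro sum.cong) (auto simp: f_def qcomp_qentry)
    then show ?thesis
      using that by (simp add: qcomp_sum qcomp_mult(1)[of c _ "qentry _ _ _"])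
  qed
  then have "(\<lambda>(c, i, j)\<in>?I. qcomp c (\<Sum>m<n. qcnj (V $$ (m, i)) * qentry w m j))
      = (\<lambda>q\<in>?I. \<Sum>p\<in>?I. f q p * w p)" for w
    by (intro restrict_ext) auto
  then show ?thesis
    using h ff by (simp add: nn_integral_std_normals_orthonormal power2_eq_square)
qed

section \<open>Moments and inverse moments of a Gaussian row\<close>

lemma nn_integral_std_normal_square: "(\<integral>\<^sup>+y. ennreal (y\<^sup>2) \<partial>std_normal) = 1"
proof -
  have "(\<integral>\<^sup>+y. ennreal (y\<^sup>2) \<partial>std_normal) = (\<integral>\<^sup>+y. ennreal (std_normal_density y * y ^ (2 * 1)) \<partial>lborel)"
    by (simp add: std_normal_def nn_integral_density ennreal_mult')
  also have "\<dots> = 1"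
    using std_normal_moment_even[of 1]
    by (subst nn_integral_eq_integral) (auto simp: has_bochner_integral_iff)
  finally show ?thesis .
qed

text \<open>Outside \<open>[-1, 1]\<close> the integrand is at most 1. Inside, the density is at
  most \<open>1 / 2\<close>, and the integral of \<open>|y|^(-1/2)\<close> over each half is 2; so
  \<open>3 = 1 + (2 + 2) / 2\<close>.\<close>

lemma nn_integral_std_normal_inverse_sqrt:
  "(\<integral>\<^sup>+y. inverse (ennreal (sqrt \<bar>y\<bar>)) \<partial>std_normal) \<le> 3"
proof -
  let ?g = "\<lambda>y. ennreal (y powr (- 1 / 2)) * indicator {0..1::real} y"
  have g: "(\<integral>\<^sup>+y. ?g y \<partial>lborel) = 2"
    using nn_integral_has_integral_lebesgue'[OF _ has_integral_powr_from_0[of "- 1 / 2" 1]] by simp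
  have g': "(\<integral>\<^sup>+y. ?g (- y) \<partial>lborel) = 2"
    using nn_integral_real_affine[of ?g "-1" 0] g by simp
  have d: "std_normal_density y \<le> 1 / 2" for y
  proof -
    have "2 \<le> sqrt (2 * pi)"
      using pi_ge_two by (intro real_le_rsqrt) simp
    then have "1 / sqrt (2 * pi) * exp (- y\<^sup>2 / 2) \<le> 1 / 2 * 1"
      by (intro mult_mono) (auto simp: field_simps)
    then show ?thesis by (simp add: std_normal_density_def)
  qed
  have pw: "inverse (ennreal (sqrt \<bar>y\<bar>)) \<le> 1 + (?g y + ?g (- y))" if y0: "y \<noteq> 0" for y
  proof -
    have e: "inverse (ennreal (sqrt \<bar>y\<bar>)) = ennreal (\<bar>y\<bar> powr (- 1 / 2))"
      using y0 by (simp add: inverse_ennreal powr_minus powr_half_sqrt)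
    consider "1 < \<bar>y\<bar>" | "0 < y" "y \<le> 1" | "y < 0" "-1 \<le> y" using y0 by linarith
    then show ?thesis
    proof cases
      case 1
      then have "\<bar>y\<bar> powr (- 1 / 2) \<le> 1"
        by (simp add: powr_minus powr_half_sqrt field_simps)
      then show ?thesis
        unfolding e by (metis add_increasing2 ennreal_1 ennreal_leI zero_le)
    next
      case 2
      then show ?thesis using e by (simp add: add_increasing)
    next
      case 3
      then show ?thesis using e by (simp add: add_increasing)
    qed
  qed
  \<comment> \<open>At \<open>y = 0\<close> the pointwise bound fails: the left side is infinite,
    while \<open>?g\<close> is 0 there because \<open>0 powr a = 0\<close>.\<close>
  have AE: "AE y in std_normal. y \<noteq> 0"
    unfolding std_normal_def using AE_lborel_singleton[of "0::real"] by (subst AE_density) auto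
  have "(\<integral>\<^sup>+y. inverse (ennreal (sqrt \<bar>y\<bar>)) \<partial>std_normal) \<le> (\<integral>\<^sup>+y. 1 + (?g y + ?g (- y)) \<partial>std_normal)"
  proof (rule nn_integral_mono_AE)
    show "AE y in std_normal. inverse (ennreal (sqrt \<bar>y\<bar>)) \<le> 1 + (?g y + ?g (- y))"
      using AE by eventually_elim (rule pw)
  qed
  also have "\<dots> = 1 + (\<integral>\<^sup>+y. ?g y + ?g (- y) \<partial>std_normal)"
    by (subst nn_integral_add) (auto simp: std_normal.emeasure_space_1[simplified])
  also have "(\<integral>\<^sup>+y. ?g y + ?g (- y) \<partial>std_normal)
      = (\<integral>\<^sup>+y. ennreal (std_normal_density y) * (?g y + ?g (- y)) \<partial>lborel)"
    by (simp add: std_normal_def nn_integral_density)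
  also have "\<dots> \<le> (\<integral>\<^sup>+y. ennreal (1 / 2) * (?g y + ?g (- y)) \<partial>lborel)"
    using d by (intro nn_integral_mono mult_right_mono ennreal_leI) auto
  also have "\<dots> = ennreal (1 / 2) * (2 + 2)"
    using g g' by (subst nn_integral_cmult) (auto simp: nn_integral_add)
  also have "\<dots> = 2"
    using ennreal_mult'[of "1 / 2" 4] by simp
  finally show ?thesis
    by (simp add: one_add_one add.commute flip: numeral_3_eq_3)
qed

text \<open>AM-GM for four squares, from the two-term inequality applied twice. The product form
  separates the coordinates and leaves each with the integrable singularity
  \<open>|z c|^(-1/2)\<close>.\<close>

lemma inverse_sum_squares_le:
  fixes z :: "nat \<Rightarrow> real"
  shows "inverse (ennreal (\<Sum>c<4. (z c)\<^sup>2)) \<le> ennreal (1 / 4) * (\<Prod>c<4. inverse (ennreal (sqrt \<bar>z c\<bar>)))"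
proof (cases "\<forall>c<4. z c \<noteq> 0")
  \<comment> \<open>A vanishing coordinate gives an infinite factor and no factor is 0, so the right
    side is infinite.\<close>
  case False
  then obtain c where "c < 4" "z c = 0" by auto
  then have "(\<Prod>c<4. inverse (ennreal (sqrt \<bar>z c\<bar>))) = \<infinity>"
    by (subst prod.remove[of _ c]) (auto simp: ennreal_top_mult prod_zero_iff)
  then show ?thesis by (simp add: ennreal_mult_top)
next
  case True
  define P where "P = (\<Prod>c<4. sqrt \<bar>z c\<bar>)"
  have P: "0 < P" using True by (auto simp: P_def intro!: prod_pos)
  have "2 * (a * b) \<le> a\<^sup>2 + b\<^sup>2" for a b :: real
    using sum_squares_bound[of a b] by simp
  note amgm = this
  have "4 * P \<le> 2 * (\<bar>z 0\<bar> * \<bar>z 1\<bar>) + 2 * (\<bar>z 2\<bar> * \<bar>z 3\<bar>)"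
  proof -
    have "2 * (sqrt (\<bar>z 0\<bar> * \<bar>z 1\<bar>) * sqrt (\<bar>z 2\<bar> * \<bar>z 3\<bar>)) \<le> \<bar>z 0\<bar> * \<bar>z 1\<bar> + \<bar>z 2\<bar> * \<bar>z 3\<bar>"
      using amgm[of "sqrt (\<bar>z 0\<bar> * \<bar>z 1\<bar>)" "sqrt (\<bar>z 2\<bar> * \<bar>z 3\<bar>)"] by simp
    then show ?thesis by (simp add: P_def lessThan_4 real_sqrt_mult)
  qed
  also have "\<dots> \<le> (\<Sum>c<4. (z c)\<^sup>2)"
    using amgm[of "\<bar>z 0\<bar>" "\<bar>z 1\<bar>"] amgm[of "\<bar>z 2\<bar>" "\<bar>z 3\<bar>"] by (simp add: lessThan_4)
  finally have le: "4 * P \<le> (\<Sum>c<4. (z c)\<^sup>2)" .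
  have "inverse (ennreal (\<Sum>c<4. (z c)\<^sup>2)) \<le> inverse (ennreal (4 * P))"
  proof -
    have "inverse (\<Sum>c<4. (z c)\<^sup>2) \<le> inverse (4 * P)"
      using le P by (intro le_imp_inverse_le) auto
    then have "ennreal (inverse (\<Sum>c<4. (z c)\<^sup>2)) \<le> ennreal (inverse (4 * P))"
      by (rule ennreal_leI)
    moreover have "0 < 4 * P" "0 < (\<Sum>c<4. (z c)\<^sup>2)" using le P by linarith+
    ultimately show ?thesis by (simp only: inverse_ennreal)
  qed
  also have "\<dots> = ennreal (1 / 4) * (\<Prod>c<4. inverse (ennreal (sqrt \<bar>z c\<bar>)))"
  proof -
    have "(\<Prod>c<4. inverse (ennreal (sqrt \<bar>z c\<bar>))) = (\<Prod>c<4. ennreal (inverse (sqrt \<bar>z c\<bar>)))"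
      using True by (intro prod.cong) (auto simp: inverse_ennreal)
    also have "\<dots> = ennreal (inverse P)"
      by (subst prod_ennreal) (auto simp: P_def prod_inversef[symmetric] o_def)
    finally show ?thesis
      using P by (simp add: inverse_ennreal ennreal_mult'[symmetric])
  qed
  finally show ?thesis .
qed

text \<open>\<open>81 / 4\<close> is \<open>3^4 / 4\<close>: AM-GM followed by independence of the
  four components. The exact value for a chi-squared variable with four degrees of freedom is
  \<open>1 / 2\<close>; finiteness is what counts.\<close>

lemma nn_integral_inverse_norm_sq_qrow:
  assumes "finite R" "i \<in> R" "(\<Sum>j<l. (norm (e j))\<^sup>2) = 1"
  shows "(\<integral>\<^sup>+w. inverse (ennreal ((norm (\<Sum>j<l. qentry w i j * e j))\<^sup>2)) \<partial>std_normals (qindex R l))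
    \<le> ennreal (81 / 4)"
proof -
  have "(\<integral>\<^sup>+w. inverse (ennreal ((norm (\<Sum>j<l. qentry w i j * e j))\<^sup>2)) \<partial>std_normals (qindex R l))
      = (\<integral>\<^sup>+z. inverse (ennreal (\<Sum>c<4. (z c)\<^sup>2)) \<partial>std_normals {..<4::nat})"
    using nn_integral_std_normals_qrow[OF assms, of "\<lambda>z. inverse (ennreal (\<Sum>c<4. (z c)\<^sup>2))"]
    by (simp add: norm_sq_qcomp)
  also have "\<dots> \<le> (\<integral>\<^sup>+z. ennreal (1 / 4) * (\<Prod>c<4. inverse (ennreal (sqrt \<bar>z c\<bar>))) \<partial>std_normals {..<4::nat})"
    by (intro nn_integral_mono inverse_sum_squares_le)
  also have "\<dots> = ennreal (1 / 4) * (\<Prod>c<4::nat. \<integral>\<^sup>+y. inverse (ennreal (sqrt \<bar>y\<bar>)) \<partial>std_normal)"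
    using std_normals.product_nn_integral_prod[of "{..<4::nat}" "\<lambda>_ y. inverse (ennreal (sqrt \<bar>y\<bar>))"]
    by (subst nn_integral_cmult) auto
  also have "\<dots> \<le> ennreal (1 / 4) * (\<Prod>c<4::nat. 3)"
    by (intro mult_left_mono prod_mono_ennreal nn_integral_std_normal_inverse_sqrt) simp
  also have "\<dots> = ennreal (81 / 4)"
    by (simp add: ennreal_power flip: ennreal_numeral ennreal_mult')
  finally show ?thesis .
qed

lemma nn_integral_norm_sq_qrow:
  assumes R: "finite R" "i \<in> R"
  shows "(\<integral>\<^sup>+w. ennreal ((norm (\<Sum>j<l. qentry w i j * x j))\<^sup>2) \<partial>std_normals (qindex R l))
    = ennreal (4 * (\<Sum>j<l. (norm (x j))\<^sup>2))"
proof (cases "(\<Sum>j<l. (norm (x j))\<^sup>2) = 0")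
  case True
  then have "x j = 0" if "j < l" for j
    using that by (simp add: sum_nonneg_eq_0_iff)
  then show ?thesis by simp
next
  case False
  define s where "s = (\<Sum>j<l. (norm (x j))\<^sup>2)"
  have s: "0 < s" using False by (simp add: s_def sum_nonneg order.strict_iff_order)
  define e where "e j = (1 / sqrt s) *\<^sub>R x j" for j
  have e: "(\<Sum>j<l. (norm (e j))\<^sup>2) = 1"
    using s by (simp add: e_def power_mult_distrib power_divide s_def flip: sum_divide_distrib)
  have x: "(norm (\<Sum>j<l. qentry w i j * x j))\<^sup>2 = s * (norm (\<Sum>j<l. qentry w i j * e j))\<^sup>2" for w
  proof -
    have "(\<Sum>j<l. qentry w i j * x j) = sqrt s *\<^sub>R (\<Sum>j<l. qentry w i j * e j)"
      using s by (simp add: e_def scaleR_sum_right)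
    then show ?thesis using s by (simp add: power_mult_distrib)
  qed
  have "(\<integral>\<^sup>+w. ennreal ((norm (\<Sum>j<l. qentry w i j * x j))\<^sup>2) \<partial>std_normals (qindex R l))
      = (\<integral>\<^sup>+z. ennreal (s * (\<Sum>c<4. (z c)\<^sup>2)) \<partial>std_normals {..<4::nat})"
    using nn_integral_std_normals_qrow[OF R e, of "\<lambda>z. ennreal (s * (\<Sum>c<4. (z c)\<^sup>2))"]
    unfolding x unfolding norm_sq_qcomp by simp
  also have "\<dots> = ennreal s * (\<Sum>c<4. \<integral>\<^sup>+z. ennreal ((z c)\<^sup>2) \<partial>std_normals {..<4::nat})"
    using s by (simp add: ennreal_mult' sum_nonneg nn_integral_cmult nn_integral_sum flip: sum_ennreal)
  also have "\<dots> = ennreal s * (\<Sum>c<4::nat. \<integral>\<^sup>+y. ennreal (y\<^sup>2) \<partial>std_normal)"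
  proof (intro arg_cong[where f = "(*) (ennreal s)"] sum.cong refl)
    fix c :: nat assume "c \<in> {..<4}"
    then have "distr (std_normals {..<4}) std_normal (\<lambda>z. z c) = std_normal"
      by (intro std_normals.PiM_component)
    then show "(\<integral>\<^sup>+z. ennreal ((z c)\<^sup>2) \<partial>std_normals {..<4}) = (\<integral>\<^sup>+y. ennreal (y\<^sup>2) \<partial>std_normal)"
      using \<open>c \<in> {..<4}\<close>
        nn_integral_distr[of "\<lambda>z. z c" "std_normals {..<4}" std_normal "\<lambda>y. ennreal (y\<^sup>2)"] by simp
  qed
  also have "\<dots> = ennreal (4 * s)"
    using s by (simp add: nn_integral_std_normal_square mult.commute flip: ennreal_numeral ennreal_mult')
  finally show ?thesis by (simp add: s_def)
qed

section \<open>The expected least-squares cost\<close>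

text \<open>For \<open>\<alpha> = 2 * c\<^sup>2\<close> and \<open>\<beta> = 2 * b\<^sup>2\<close>,
  the share of column \<open>k\<close> in the pathwise bound on the squared excess error. Being a
  penalty and not a constraint, the \<open>\<alpha>\<close> part keeps the cost finite and
  continuous in \<open>x\<close>.\<close>

definition solution_cost ::
  "real \<Rightarrow> real \<Rightarrow> nat \<Rightarrow> nat \<Rightarrow> nat \<Rightarrow> nat \<Rightarrow> (nat \<times> nat \<times> nat \<Rightarrow> real) \<Rightarrow> (nat \<Rightarrow> quat) \<Rightarrow> real" where
  "solution_cost \<alpha> \<beta> n l L k z x =
    \<alpha> * (\<Sum>i<L. (norm ((if i = k then 1 else 0) - (\<Sum>j<l. qentry z i j * x j)))\<^sup>2)
    + \<beta> * (\<Sum>i=L..<n. (norm (\<Sum>j<l. qentry z i j * x j))\<^sup>2)"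

text \<open>The infimum runs over rational vectors only, which makes it measurable in \<open>z\<close>.\<close>

definition min_solution_cost ::
  "real \<Rightarrow> real \<Rightarrow> nat \<Rightarrow> nat \<Rightarrow> nat \<Rightarrow> nat \<Rightarrow> (nat \<times> nat \<times> nat \<Rightarrow> real) \<Rightarrow> ennreal" where
  "min_solution_cost \<alpha> \<beta> n l L k z =
    (INF r\<in>Pi\<^sub>E (qindex {0} l) (\<lambda>_. \<rat>). ennreal (solution_cost \<alpha> \<beta> n l L k z (qentry r 0)))"

lemma solution_cost_nonneg: "0 \<le> \<alpha> \<Longrightarrow> 0 \<le> \<beta> \<Longrightarrow> 0 \<le> solution_cost \<alpha> \<beta> n l L k z x"
  by (simp add: solution_cost_def sum_nonneg)

lemma qcomp_minus: "qcomp c (x - y) = qcomp c x - qcomp c y"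
  by (simp add: qcomp_def minus_quat_def)

lemma qcomp_qrow: "qcomp c (\<Sum>j<l. qentry z i j * x j) = (\<Sum>j<l. \<Sum>d<4. qcomp c (qunit d * x j) * z (d, i, j))"
  by (simp add: qcomp_sum qcomp_mult(2)[of c "qentry _ _ _"] qcomp_qentry)

lemma solution_cost_measurable [measurable]:
  assumes "L \<le> n"
  shows "(\<lambda>z. solution_cost \<alpha> \<beta> n l L k z x) \<in> borel_measurable (Pi\<^sub>M (qindex {..<n} l) (\<lambda>_. borel))"
proof -
  have c: "(\<lambda>z. \<Sum>j<l. \<Sum>d<4. qcomp c (qunit d * x j) * z (d, i, j))
      \<in> borel_measurable (Pi\<^sub>M (qindex {..<n} l) (\<lambda>_. borel))" if "i < n" for c i
    using that by (intro borel_measurable_sum borel_measurable_times borel_measurable_const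
        measurable_component_singleton) auto
  show ?thesis
    unfolding solution_cost_def norm_sq_qcomp qcomp_minus qcomp_qrow using assms
    by (intro borel_measurable_add borel_measurable_times borel_measurable_const borel_measurable_sum
        borel_measurable_power borel_measurable_diff c) auto
qed

text \<open>Vectors are coded as row 0 of a flattened matrix; extensional rational functions on the
  finite set \<open>qindex {0} l\<close> are countable in number.\<close>

lemma min_solution_cost_measurable [measurable]:
  assumes "L \<le> n"
  shows "min_solution_cost \<alpha> \<beta> n l L k \<in> borel_measurable (Pi\<^sub>M (qindex {..<n} l) (\<lambda>_. borel))"
  unfolding min_solution_cost_def using assms
  by (intro borel_measurable_INF countable_PiE countable_rat measurable_compose[OF _ measurable_ennreal]
      solution_cost_measurable) auto

lemma tendsto_Quat:
  assumes "(a \<longlongrightarrow> a') F" "(b \<longlongrightarrow> b') F" "(c \<longlongrightarrow> c') F" "(d \<longlongrightarrow> d') F"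
  shows "((\<lambda>n. Quat (a n) (b n) (c n) (d n)) \<longlongrightarrow> Quat a' b' c' d') F"
proof -
  have Q: "Quat a b c d = a *\<^sub>R Quat 1 0 0 0 + b *\<^sub>R Quat 0 1 0 0 + c *\<^sub>R Quat 0 0 1 0 + d *\<^sub>R Quat 0 0 0 1"
    for a b c d
    by (simp add: scaleR_quat_def plus_quat_def)
  show ?thesis
    unfolding Q[of "a _"] Q[of a'] by (intro tendsto_intros assms)
qed

text \<open>The cost is continuous in \<open>x\<close>, so rational approximations of an arbitrary
  \<open>x\<close> suffice; they need not solve any equation themselves.\<close>

lemma min_solution_cost_le: "min_solution_cost \<alpha> \<beta> n l L k z \<le> ennreal (solution_cost \<alpha> \<beta> n l L k z x)"
proof -
  have "\<exists>s. (\<forall>n. s n \<in> \<rat>) \<and> s \<longlonglongrightarrow> y" for y :: real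
    using closure_sequential[of y \<rat>] by (simp add: Rats_closure_real)
  then obtain s where s: "s y n \<in> \<rat>" "s y \<longlonglongrightarrow> y" for y :: real and n
    by metis
  define r where "r n = (\<lambda>(c, i, j)\<in>qindex {0} l. s (qcomp c (x j)) n)" for n
  have r: "(\<lambda>n. qentry (r n) 0 j) \<longlonglongrightarrow> x j" if "j < l" for j
  proof -
    have "(\<lambda>n. Quat (s (qcomp 0 (x j)) n) (s (qcomp 1 (x j)) n) (s (qcomp 2 (x j)) n) (s (qcomp 3 (x j)) n))
        \<longlonglongrightarrow> Quat (qcomp 0 (x j)) (qcomp 1 (x j)) (qcomp 2 (x j)) (qcomp 3 (x j))"
      by (intro tendsto_Quat s)
    then show ?thesis
      using that by (simp add: r_def qentry_def qcomp_def)
  qed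
  have "(\<lambda>m. ennreal (solution_cost \<alpha> \<beta> n l L k z (qentry (r m) 0)))
      \<longlonglongrightarrow> ennreal (solution_cost \<alpha> \<beta> n l L k z x)"
    unfolding solution_cost_def by (intro tendsto_ennrealI tendsto_intros r) auto
  moreover have "min_solution_cost \<alpha> \<beta> n l L k z \<le> ennreal (solution_cost \<alpha> \<beta> n l L k z (qentry (r m) 0))" for m
    unfolding min_solution_cost_def using s(1) by (intro INF_lower) (auto simp: r_def PiE_iff)
  ultimately show ?thesis
    by (intro LIMSEQ_le_const) auto
qed

text \<open>The choices for different \<open>k\<close> are independent, so near-minimisers can be
  combined. The sum may be assumed finite, which makes every infimum finite and strictly improvable
  by a positive slack.\<close>

lemma le_sum_INF_ennreal:
  fixes g :: "'k \<Rightarrow> 'r \<Rightarrow> ennreal"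
  assumes "finite A" and le: "\<And>r. (\<And>k. k \<in> A \<Longrightarrow> r k \<in> D) \<Longrightarrow> X \<le> (\<Sum>k\<in>A. g k (r k))"
  shows "X \<le> (\<Sum>k\<in>A. INF r\<in>D. g k r)"
proof (rule ennreal_le_epsilon)
  fix e :: real
  assume fin: "(\<Sum>k\<in>A. INF r\<in>D. g k r) < Orderings.top" and e: "0 < e"
  \<comment> \<open>The \<open>+ 1\<close> avoids division by 0 when \<open>A\<close> is
    empty.\<close>
  define d where "d = e / (real (card A) + 1)"
  have d: "0 < d" using e by (simp add: d_def)
  have "\<exists>r\<in>D. g k r < (INF r\<in>D. g k r) + ennreal d" if "k \<in> A" for k
  proof -
    have "(INF r\<in>D. g k r) < Orderings.top"
      using fin that assms(1) by simp
    then have "(INF r\<in>D. g k r) < (INF r\<in>D. g k r) + ennreal d"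
      using d by (cases "INF r\<in>D. g k r") (simp_all add: ennreal_less_iff flip: ennreal_plus)
    then show ?thesis by (simp add: INF_less_iff)
  qed
  then obtain r where r: "\<And>k. k \<in> A \<Longrightarrow> r k \<in> D \<and> g k (r k) < (INF r\<in>D. g k r) + ennreal d"
    by metis
  have "X \<le> (\<Sum>k\<in>A. g k (r k))"
    using r by (intro le) auto
  also have "\<dots> \<le> (\<Sum>k\<in>A. (INF r\<in>D. g k r) + ennreal d)"
    using r by (intro sum_mono order.strict_implies_order) auto
  also have "\<dots> = (\<Sum>k\<in>A. INF r\<in>D. g k r) + ennreal (card A * d)"
    using d by (simp add: sum.distrib ennreal_mult' ennreal_of_nat_eq_real_of_nat)
  also have "\<dots> \<le> (\<Sum>k\<in>A. INF r\<in>D. g k r) + ennreal e"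
    using e by (intro add_left_mono ennreal_leI) (simp add: d_def field_simps)
  finally show "X \<le> (\<Sum>k\<in>A. INF r\<in>D. g k r) + ennreal e" .
qed

text \<open>The rows are split into \<open>x\<close> (before \<open>L\<close>, except
  \<open>k\<close>), \<open>u\<close> (row \<open>k\<close>) and \<open>v\<close> (from
  \<open>L\<close> on). The vectors \<open>e\<close> depend on \<open>x\<close> alone and the
  solution on \<open>x\<close> and \<open>u\<close>, so the solution is constant while
  \<open>v\<close> is integrated. \<open>inner\<close> is shown for each fixed \<open>x\<close> with
  a bound free of \<open>x\<close>, so \<open>e\<close> may depend on \<open>x\<close> in any
  manner. The solution is exact, hence \<open>\<alpha>\<close> does not appear in the bound.\<close>

lemma nn_integral_min_solution_cost:
  assumes k: "k < L" and n: "L \<le> n" and l: "L + P = l" and \<alpha>\<beta>: "0 \<le> \<alpha>" "0 \<le> \<beta>"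
  shows "(\<integral>\<^sup>+z. min_solution_cost \<alpha> \<beta> n l L k z \<partial>std_normals (qindex {..<n} l))
    \<le> ennreal (81 * \<beta> * (real n - real L) / (real P + 1))"
proof -
  let ?h = "min_solution_cost \<alpha> \<beta> n l L k"
  let ?O = "{..<L} - {k}" and ?R = "{L..<n}"
  let ?IO = "qindex ?O l" and ?IK = "qindex {k} l" and ?IR = "qindex ?R l"
  let ?J = "?IK \<union> ?IR"
  let ?m = "\<lambda>x u v. merge ?IO ?J (x, merge ?IK ?IR (u, v))"
  have IJ: "qindex {..<n} l = ?IO \<union> ?J" using k n by auto
  have disj: "?IO \<inter> ?J = {}" "?IK \<inter> ?IR = {}" using k by auto
  have h [measurable]: "?h \<in> borel_measurable (Pi\<^sub>M (?IO \<union> ?J) (\<lambda>_. std_normal))"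
    using min_solution_cost_measurable[OF n, of \<alpha> \<beta> l k]
    by (simp add: IJ cong: measurable_cong_sets sets_std_normals)
  \<comment> \<open>The 4 is the second moment of one Gaussian row against a unit vector,
    \<open>n - L\<close> counts the rows, and \<open>(P + 1)^2\<close> comes from averaging. The
    \<open>P + 1\<close> inverse moments, at most \<open>81 / 4\<close> each, then cancel one factor
    \<open>P + 1\<close>.\<close>
  define C where "C = 4 * \<beta> * (real n - real L) / (real P + 1)\<^sup>2"
  have C: "0 \<le> C" using \<alpha>\<beta> n by (simp add: C_def)
  have row: "qentry (?m x u v) i j = (if i \<in> ?O then qentry x i j else if i = k then qentry u i j else qentry v i j)"
    if "i < n" "j < l" for x u v i j
    using that k by (auto simp: qentry_def merge_def)
  have inner: "(\<integral>\<^sup>+u. \<integral>\<^sup>+v. ?h (?m x u v) \<partial>std_normals ?IR \<partial>std_normals ?IK)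
      \<le> ennreal (81 * \<beta> * (real n - real L) / (real P + 1))" for x
  proof -
    \<comment> \<open>Here \<open>card ?O = L - 1\<close> and \<open>L + P = l\<close>: the
      dimension count admits exactly \<open>P + 1\<close> null vectors.\<close>
    have "card ?O + (P + 1) \<le> l" using k l by (simp add: card_Diff_singleton)
    then obtain e :: "nat \<Rightarrow> nat \<Rightarrow> quat" where
      xe: "\<And>i t. i \<in> ?O \<Longrightarrow> t < P + 1 \<Longrightarrow> (\<Sum>j<l. qentry x i j * e t j) = 0" and
      ee: "\<And>s t. s < P + 1 \<Longrightarrow> t < P + 1 \<Longrightarrow> (\<Sum>j<l. qcnj (e s j) * e t j) = (if s = t then 1 else 0)"
      using quat_orthonormal_null_vectors[of ?O "P + 1" l "qentry x"] by auto
    define y where "y u t = (\<Sum>j<l. qentry u k j * e t j)" for u t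
    have e1: "(\<Sum>j<l. (norm (e t j))\<^sup>2) = 1" if "t < P + 1" for t
    proof -
      have "q_re (\<Sum>j<l. qcnj (e t j) * e t j) = 1"
        using ee[OF that that] by (simp add: one_quat_def)
      then show ?thesis by (simp add: q_re_sum mult_qcnj)
    qed
    have y_le: "(\<integral>\<^sup>+u. inverse (ennreal ((norm (y u t))\<^sup>2)) \<partial>std_normals ?IK) \<le> ennreal (81 / 4)"
      if "t < P + 1" for t
      unfolding y_def by (intro nn_integral_inverse_norm_sq_qrow e1 that) auto
    have y_meas [measurable]: "(\<lambda>u. (norm (y u t))\<^sup>2) \<in> borel_measurable (Pi\<^sub>M ?IK (\<lambda>_. borel))" for t
      unfolding y_def norm_sq_qcomp qcomp_qrow
      by (intro borel_measurable_sum borel_measurable_times borel_measurable_const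
          borel_measurable_power measurable_component_singleton) auto
    \<comment> \<open>The finite inverse moment already excludes zeros of \<open>y u t\<close>
      outside a null set.\<close>
    have AE: "AE u in std_normals ?IK. \<forall>t\<in>{..<P + 1}. y u t \<noteq> 0"
    proof (rule AE_finite_allI)
      fix t assume "t \<in> {..<P + 1}"
      then have "AE u in std_normals ?IK. inverse (ennreal ((norm (y u t))\<^sup>2)) \<noteq> \<infinity>"
        using y_le[of t] by (intro nn_integral_PInf_AE) (auto simp: top_unique, measurable)
      then show "AE u in std_normals ?IK. y u t \<noteq> 0"
        by (rule eventually_mono) auto
    qed simp
    have bound: "(\<integral>\<^sup>+v. ?h (?m x u v) \<partial>std_normals ?IR)
        \<le> ennreal C * (\<Sum>t<P + 1. inverse (ennreal ((norm (y u t))\<^sup>2)))"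
      if u: "\<forall>t\<in>{..<P + 1}. y u t \<noteq> 0" for u
    proof -
      have y0: "(\<Sum>j<l. qentry u k j * e t j) \<noteq> 0" if "t < P + 1" for t
        using u that by (simp add: y_def)
      obtain s where s: "(\<Sum>j<l. qentry u k j * s j) = 1"
        "\<And>a. (\<And>t. t < P + 1 \<Longrightarrow> (\<Sum>j<l. a j * e t j) = 0) \<Longrightarrow> (\<Sum>j<l. a j * s j) = 0"
        "(\<Sum>j<l. (norm (s j))\<^sup>2) = (\<Sum>t<P + 1. 1 / (norm (\<Sum>j<l. qentry u k j * e t j))\<^sup>2) / (real (P + 1))\<^sup>2"
        using quat_averaged_solution[OF _ ee y0, of "P + 1"] by auto
      have cost: "solution_cost \<alpha> \<beta> n l L k (?m x u v) s = \<beta> * (\<Sum>i\<in>?R. (norm (\<Sum>j<l. qentry v i j * s j))\<^sup>2)" for v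
      proof -
        have "(\<Sum>j<l. qentry (?m x u v) i j * s j) = (if i = k then 1 else 0)" if "i < L" for i
        proof (cases "i = k")
          case True
          then show ?thesis using s(1) k n by (simp add: row)
        next
          case False
          then show ?thesis using s(2)[of "qentry x i"] xe[of i] that n by (simp add: row)
        qed
        then have "(\<Sum>i<L. (norm ((if i = k then 1 else 0) - (\<Sum>j<l. qentry (?m x u v) i j * s j)))\<^sup>2) = 0"
          by (intro sum.neutral) auto
        moreover have "(\<Sum>i\<in>?R. (norm (\<Sum>j<l. qentry (?m x u v) i j * s j))\<^sup>2)
            = (\<Sum>i\<in>?R. (norm (\<Sum>j<l. qentry v i j * s j))\<^sup>2)"
          using k by (intro sum.cong refl) (auto simp: row)
        ultimately show ?thesis by (simp add: solution_cost_def)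
      qed
      have "(\<integral>\<^sup>+v. ?h (?m x u v) \<partial>std_normals ?IR)
          \<le> (\<integral>\<^sup>+v. ennreal (\<beta> * (\<Sum>i\<in>?R. (norm (\<Sum>j<l. qentry v i j * s j))\<^sup>2)) \<partial>std_normals ?IR)"
        unfolding cost[symmetric] by (intro nn_integral_mono min_solution_cost_le)
      also have "\<dots> = ennreal \<beta> * (\<Sum>i\<in>?R. \<integral>\<^sup>+v. ennreal ((norm (\<Sum>j<l. qentry v i j * s j))\<^sup>2) \<partial>std_normals ?IR)"
      proof -
        have m: "(\<lambda>v. ennreal ((norm (\<Sum>j<l. qentry v i j * s j))\<^sup>2)) \<in> borel_measurable (std_normals ?IR)"
          if "i \<in> ?R" for i
        proof -
          have "(\<lambda>v. (norm (\<Sum>j<l. qentry v i j * s j))\<^sup>2) \<in> borel_measurable (Pi\<^sub>M ?IR (\<lambda>_. borel))"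
            unfolding norm_sq_qcomp qcomp_qrow using that
            by (intro borel_measurable_sum borel_measurable_times borel_measurable_const
                borel_measurable_power measurable_component_singleton) auto
          then show ?thesis by measurable
        qed
        have "(\<integral>\<^sup>+v. ennreal (\<beta> * (\<Sum>i\<in>?R. (norm (\<Sum>j<l. qentry v i j * s j))\<^sup>2)) \<partial>std_normals ?IR)
            = (\<integral>\<^sup>+v. ennreal \<beta> * (\<Sum>i\<in>?R. ennreal ((norm (\<Sum>j<l. qentry v i j * s j))\<^sup>2)) \<partial>std_normals ?IR)"
          using \<alpha>\<beta> by (simp add: ennreal_mult' sum_ennreal)
        also have "\<dots> = ennreal \<beta> * (\<integral>\<^sup>+v. (\<Sum>i\<in>?R. ennreal ((norm (\<Sum>j<l. qentry v i j * s j))\<^sup>2)) \<partial>std_normals ?IR)"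
          by (intro nn_integral_cmult borel_measurable_sum m)
        also have "(\<integral>\<^sup>+v. (\<Sum>i\<in>?R. ennreal ((norm (\<Sum>j<l. qentry v i j * s j))\<^sup>2)) \<partial>std_normals ?IR)
            = (\<Sum>i\<in>?R. \<integral>\<^sup>+v. ennreal ((norm (\<Sum>j<l. qentry v i j * s j))\<^sup>2) \<partial>std_normals ?IR)"
          by (intro nn_integral_sum m)
        finally show ?thesis .
      qed
      also have "\<dots> = ennreal \<beta> * (\<Sum>i\<in>?R. ennreal (4 * (\<Sum>j<l. (norm (s j))\<^sup>2)))"
        by (intro arg_cong[where f = "(*) (ennreal \<beta>)"] sum.cong refl nn_integral_norm_sq_qrow) auto
      also have "\<dots> = ennreal (\<beta> * ((real n - real L) * (4 * (\<Sum>j<l. (norm (s j))\<^sup>2))))"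
        using \<alpha>\<beta> n by (simp add: ennreal_mult' ennreal_of_nat_eq_real_of_nat of_nat_diff)
      also have "\<beta> * ((real n - real L) * (4 * (\<Sum>j<l. (norm (s j))\<^sup>2)))
          = C * (\<Sum>t<P + 1. inverse ((norm (y u t))\<^sup>2))"
        unfolding s(3) C_def y_def by (simp add: field_simps del: sum.lessThan_Suc)
      also have "ennreal \<dots> = ennreal C * (\<Sum>t<P + 1. ennreal (inverse ((norm (y u t))\<^sup>2)))"
        using C by (simp add: ennreal_mult' sum_ennreal del: sum.lessThan_Suc)
      also have "(\<Sum>t<P + 1. ennreal (inverse ((norm (y u t))\<^sup>2))) = (\<Sum>t<P + 1. inverse (ennreal ((norm (y u t))\<^sup>2)))"
        using u by (intro sum.cong refl inverse_ennreal[symmetric]) simp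
      finally show ?thesis .
    qed
    have "(\<integral>\<^sup>+u. \<integral>\<^sup>+v. ?h (?m x u v) \<partial>std_normals ?IR \<partial>std_normals ?IK)
        \<le> (\<integral>\<^sup>+u. ennreal C * (\<Sum>t<P + 1. inverse (ennreal ((norm (y u t))\<^sup>2))) \<partial>std_normals ?IK)"
    proof (rule nn_integral_mono_AE)
      show "AE u in std_normals ?IK. (\<integral>\<^sup>+v. ?h (?m x u v) \<partial>std_normals ?IR)
          \<le> ennreal C * (\<Sum>t<P + 1. inverse (ennreal ((norm (y u t))\<^sup>2)))"
        using AE by eventually_elim (rule bound)
    qed
    also have "\<dots> = ennreal C * (\<Sum>t<P + 1. \<integral>\<^sup>+u. inverse (ennreal ((norm (y u t))\<^sup>2)) \<partial>std_normals ?IK)"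
    proof -
      have m: "(\<lambda>u. inverse (ennreal ((norm (y u t))\<^sup>2))) \<in> borel_measurable (std_normals ?IK)" for t
        by measurable
      show ?thesis
        by (subst nn_integral_cmult, intro borel_measurable_sum m, subst nn_integral_sum) (auto intro: m)
    qed
    also have "\<dots> \<le> ennreal C * (\<Sum>t<P + 1. ennreal (81 / 4))"
      using y_le by (intro mult_left_mono sum_mono) auto
    also have "\<dots> = ennreal (C * ((real P + 1) * (81 / 4)))"
    proof -
      have "(\<Sum>t<P + 1. ennreal (81 / 4)) = ennreal ((real P + 1) * (81 / 4))"
        by (subst sum_ennreal) auto
      then show ?thesis by (simp only: ennreal_mult'[OF C])
    qed
    also have "C * ((real P + 1) * (81 / 4)) = 81 * \<beta> * (real n - real L) / (real P + 1)"
      by (simp add: C_def power2_eq_square divide_simps)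
    finally show ?thesis .
  qed
  have "(\<integral>\<^sup>+z. ?h z \<partial>std_normals (qindex {..<n} l))
      = (\<integral>\<^sup>+x. \<integral>\<^sup>+y. ?h (merge ?IO ?J (x, y)) \<partial>std_normals ?J \<partial>std_normals ?IO)"
    unfolding IJ using disj by (intro std_normals.product_nn_integral_fold h) auto
  also have "\<dots> = (\<integral>\<^sup>+x. \<integral>\<^sup>+u. \<integral>\<^sup>+v. ?h (?m x u v) \<partial>std_normals ?IR \<partial>std_normals ?IK \<partial>std_normals ?IO)"
  proof (rule nn_integral_cong)
    fix x assume x: "x \<in> space (std_normals ?IO)"
    have "(\<lambda>y. ?h (merge ?IO ?J (x, y))) \<in> borel_measurable (std_normals ?J)"
      using measurable_compose[OF measurable_compose[OF measurable_Pair1'[OF x] measurable_merge] h] .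
    then show "(\<integral>\<^sup>+y. ?h (merge ?IO ?J (x, y)) \<partial>std_normals ?J)
        = (\<integral>\<^sup>+u. \<integral>\<^sup>+v. ?h (?m x u v) \<partial>std_normals ?IR \<partial>std_normals ?IK)"
      using disj by (intro std_normals.product_nn_integral_fold) auto
  qed
  also have "\<dots> \<le> (\<integral>\<^sup>+x. ennreal (81 * \<beta> * (real n - real L) / (real P + 1)) \<partial>std_normals ?IO)"
    by (intro nn_integral_mono inner)
  also have "\<dots> = ennreal (81 * \<beta> * (real n - real L) / (real P + 1))"
  proof -
    have "emeasure (std_normals ?IO) (space (std_normals ?IO)) = 1"
      by (intro prob_space.emeasure_space_1 prob_space_PiM) unfold_locales
    then show ?thesis by simp
  qed
  finally show ?thesis .
qed

section \<open>The error of the CoR-QURV approximation\<close>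

lemma qentry_unitary_rows:
  assumes "V \<in> carrier_mat n n" "Om \<in> carrier_mat n l" "i < n" "j < l"
    and Om: "\<And>m. m < n \<Longrightarrow> Om $$ (m, j) = qentry w m j"
  shows "(V\<^sup>H * Om) $$ (i, j)
    = qentry (\<lambda>(c, i, j)\<in>qindex {..<n} l. qcomp c (\<Sum>m<n. qcnj (V $$ (m, i)) * qentry w m j)) i j"
proof -
  have "(V\<^sup>H * Om) $$ (i, j) = (\<Sum>m<n. qcnj (V $$ (m, i)) * Om $$ (m, j))"
    using assms by (simp add: mat_H_def scalar_prod_def atLeast0LessThan)
  also have "\<dots> = (\<Sum>m<n. qcnj (V $$ (m, i)) * qentry w m j)" (is "_ = ?s")
    using Om by (intro sum.cong) auto
  also have "?s = Quat (qcomp 0 ?s) (qcomp 1 ?s) (qcomp 2 ?s) (qcomp 3 ?s)"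
    by (simp add: qcomp_def)
  finally show ?thesis
    using assms by (simp add: qentry_def[of "restrict _ _"])
qed

text \<open>Independence and the marginal laws identify the joint law with the product measure,
  which moves the computation off the abstract space \<open>S\<close>.\<close>

lemma distr_indep_std_normal_mats:
  assumes S: "prob_space S" and W: "indep_std_normal_mats S n l W 4" and nl: "0 < n" "0 < l"
  shows "(\<lambda>\<omega>. \<lambda>(c, i, j)\<in>qindex {..<n} l. W c \<omega> $$ (i, j)) \<in> S \<rightarrow>\<^sub>M Pi\<^sub>M (qindex {..<n} l) (\<lambda>_. borel)"
    and "distr S (Pi\<^sub>M (qindex {..<n} l) (\<lambda>_. borel)) (\<lambda>\<omega>. \<lambda>(c, i, j)\<in>qindex {..<n} l. W c \<omega> $$ (i, j))
      = std_normals (qindex {..<n} l)"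
proof -
  interpret prob_space S by fact
  let ?X = "\<lambda>(c, i, j) \<omega>. W c \<omega> $$ (i, j)" and ?I = "qindex {..<n} l"
  have D: "distributed S lborel (?X p) std_normal_density" if "p \<in> ?I" for p
    using W that by (auto simp: indep_std_normal_mats_def)
  have rv: "?X p \<in> borel_measurable S" if "p \<in> ?I" for p
    using distributed_measurable[OF D[OF that]] by simp
  have law: "distr S borel (?X p) = std_normal" if "p \<in> ?I" for p
  proof -
    have "distr S borel (?X p) = distr S lborel (?X p)"
      by (intro distr_cong) auto
    then show ?thesis
      using distributed_distr_eq_density[OF D[OF that]] by (simp add: std_normal_def)
  qed
  have eq: "(\<lambda>\<omega>. \<lambda>(c, i, j)\<in>?I. W c \<omega> $$ (i, j)) = (\<lambda>\<omega>. \<lambda>p\<in>?I. ?X p \<omega>)"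
    by (simp add: fun_eq_iff)
  show "(\<lambda>\<omega>. \<lambda>(c, i, j)\<in>?I. W c \<omega> $$ (i, j)) \<in> S \<rightarrow>\<^sub>M Pi\<^sub>M ?I (\<lambda>_. borel)"
    unfolding eq by (intro measurable_restrict rv)
  have "indep_vars (\<lambda>_. borel) ?X ?I"
    using W by (simp add: indep_std_normal_mats_def)
  moreover have "(0, 0, 0) \<in> ?I" using nl by simp
  then have "?I \<noteq> {}" by blast
  ultimately have "distr S (Pi\<^sub>M ?I (\<lambda>_. borel)) (\<lambda>\<omega>. \<lambda>p\<in>?I. ?X p \<omega>) = Pi\<^sub>M ?I (\<lambda>p. distr S borel (?X p))"
    using indep_vars_iff_distr_eq_PiM'[of ?I ?X "\<lambda>_. borel"] rv by simp
  also have "\<dots> = std_normals ?I"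
    by (intro PiM_cong law) auto
  finally show "distr S (Pi\<^sub>M ?I (\<lambda>_. borel)) (\<lambda>\<omega>. \<lambda>(c, i, j)\<in>?I. W c \<omega> $$ (i, j)) = std_normals ?I"
    unfolding eq .
qed

text \<open>\<open>162 = 2 * 81\<close>, where the 2 comes from squaring a sum of two terms. As
  \<open>exp 1\<close> is at least 2, the right side is at least \<open>576 N^2 / (P + 1)^2\<close>,
  and \<open>P + 1 <= N\<close> trades one factor \<open>N\<close> for \<open>P + 1\<close>.\<close>

lemma nu_sq_ge:
  assumes "P + 1 \<le> N"
  shows "162 * real N / (real P + 1)
    \<le> ((3 * (sqrt (real N) + sqrt (real N)) + 3) * (exp 1 * sqrt (4 * real N + 2) / (real P + 1)))\<^sup>2"
proof -
  let ?q = "real P + 1"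
  have q: "0 < ?q" "?q \<le> real N" using assms by auto
  have "(2::real) \<le> exp 1"
    using exp_ge_add_one_self[of "1 :: real"] by simp
  have "162 * real N / ?q \<le> (6 * sqrt (real N))\<^sup>2 * (2\<^sup>2 * (4 * real N) / ?q\<^sup>2)"
  proof -
    have "162 * real N / ?q = 162 * real N * ?q / ?q\<^sup>2"
      using q by (simp add: power2_eq_square)
    also have "\<dots> \<le> 576 * real N * real N / ?q\<^sup>2"
      using q by (intro divide_right_mono mult_mono) auto
    finally show ?thesis by (simp add: power_mult_distrib)
  qed
  also have "\<dots> \<le> (3 * (sqrt (real N) + sqrt (real N)) + 3)\<^sup>2 * ((exp 1)\<^sup>2 * (4 * real N + 2) / ?q\<^sup>2)"
    using q \<open>2 \<le> exp 1\<close> by (intro mult_mono power_mono divide_right_mono) auto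
  also have "\<dots> = ((3 * (sqrt (real N) + sqrt (real N)) + 3) * (exp 1 * sqrt (4 * real N + 2) / ?q))\<^sup>2"
    by (simp add: power_mult_distrib power_divide)
  finally show ?thesis .
qed

text \<open>If a sample matrix is rank deficient, the range of its orthonormal QR factor is not
  determined by it and could be selected in a nonmeasurable way; \<open>meas\<close> excludes this
  for the approximation. Integrability is asserted too, because the expectation of a nonintegrable
  function is 0 by convention.\<close>

theorem theorem5p6:
  fixes S :: "'w measure"
    and A U V :: "quat mat" and \<sigma> :: "nat \<Rightarrow> real"
    and M N K l P p :: nat
    and W :: "nat \<Rightarrow> 'w \<Rightarrow> real mat"
    and Om Q1 R1 Q2 R2 Q3 R3 Pm :: "'w \<Rightarrow> quat mat"
  assumes S: "prob_space S"
    and svd: "is_qsvd M N A U \<sigma> V"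
    and K: "1 \<le> K" "K \<le> l" "l \<le> min M N"
    and P: "2 \<le> P + K" "P + K \<le> l"
    and p: "1 \<le> p"
    and pos: "0 < \<sigma> K"
    and W: "indep_std_normal_mats S N l W 4"
    and Om: "\<And>\<omega>. \<omega> \<in> space S \<Longrightarrow> Om \<omega> = quat_mat (W 0 \<omega>) (W 1 \<omega>) (W 2 \<omega>) (W 3 \<omega>)"
    and run: "\<And>\<omega>. \<omega> \<in> space S \<Longrightarrow>
      cor_qurv_run M N l p A (Om \<omega>) (Q1 \<omega>) (R1 \<omega>) (Q2 \<omega>) (R2 \<omega>) (Q3 \<omega>) (R3 \<omega>) (Pm \<omega>)"
    and meas: "\<And>i j. i < M \<Longrightarrow> j < N \<Longrightarrow>
      (\<lambda>\<omega>. cor_approx A (Q1 \<omega>) (Q2 \<omega>) $$ (i, j)) \<in> borel_measurable S"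
  defines "A0 \<equiv> A - qsvd_truncation M N U \<sigma> V K"
    and "\<gamma> \<equiv> \<sigma> (l - P + 1) / \<sigma> K"
    and "\<nu> \<equiv> (3 * (sqrt (real N) + sqrt (real N)) + 3) *
      (exp 1 * sqrt (4 * real N + 2) / (real P + 1))"
  shows "integrable S (\<lambda>\<omega>. frob_norm (A - cor_approx A (Q1 \<omega>) (Q2 \<omega>)))
    \<and> prob_space.expectation S (\<lambda>\<omega>. frob_norm (A - cor_approx A (Q1 \<omega>) (Q2 \<omega>)))
      \<le> frob_norm A0 + (1 + \<gamma>) * sqrt (real K) * \<nu> * \<sigma> (l - P + 1) * \<gamma>"
proof -
  interpret prob_space S by fact
  define L where "L = l - P"
  have L: "K \<le> L" "L \<le> N" "L + P = l" and KMN: "K \<le> M" "K \<le> N" "0 < N" "0 < l"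
    using K P by (auto simp: L_def)
  let ?I = "qindex {..<N} l"
  let ?D = "\<lambda>\<omega>. frob_norm (A - cor_approx A (Q1 \<omega>) (Q2 \<omega>))"
  define c where "c = \<sigma> 1 * (1 + (\<sigma> 1 / \<sigma> K) ^ (2 * p)) * 2"
  define b where "b = \<sigma> (L + 1) * \<gamma>"
  define w where "w \<omega> = (\<lambda>(c, i, j)\<in>?I. W c \<omega> $$ (i, j))" for \<omega>
  define z where "z v = (\<lambda>(c, i, j)\<in>?I. qcomp c (\<Sum>m<N. qcnj (V $$ (m, i)) * qentry v m j))" for v
  \<comment> \<open>Positive part of the excess over \<open>frob_norm A0\<close>, scaled by
    \<open>1 + \<gamma>\<close>; nonnegativity allows the pathwise bound to be squared.\<close>
  define Y where "Y \<omega> = max 0 ((?D \<omega> - frob_norm A0) / (1 + \<gamma>))" for \<omega>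
  have A: "A \<in> carrier_mat M N" and V: "unitary_quat_mat N V" and nonneg: "\<And>i. 0 \<le> \<sigma> i"
    using svd by (auto simp: is_qsvd_def)
  have \<gamma>: "0 \<le> \<gamma>" using nonneg pos by (simp add: \<gamma>_def)
  have cV: "V \<in> carrier_mat N N" using V by (simp add: unitary_quat_mat_def)
  have Q: "orthonormal_cols M l (Q1 \<omega>)" "orthonormal_cols N l (Q2 \<omega>)" if "\<omega> \<in> space S" for \<omega>
    using run[OF that] by (auto simp: cor_qurv_run_def thin_qr_def)
  have Om_carrier: "Om \<omega> \<in> carrier_mat N l"
    and Om_entry: "\<And>i j. i < N \<Longrightarrow> j < l \<Longrightarrow> Om \<omega> $$ (i, j) = qentry (w \<omega>) i j" if "\<omega> \<in> space S" for \<omega>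
  proof -
    have "W 0 \<omega> \<in> carrier_mat N l"
      using W that by (auto simp: indep_std_normal_mats_def)
    then show "Om \<omega> \<in> carrier_mat N l"
      "\<And>i j. i < N \<Longrightarrow> j < l \<Longrightarrow> Om \<omega> $$ (i, j) = qentry (w \<omega>) i j"
      by (auto simp: Om[OF that] quat_mat_def qentry_def w_def)
  qed
  have D_meas [measurable]: "?D \<in> borel_measurable S"
  proof -
    have "(\<lambda>\<omega>. norm (A $$ (i, j) - cor_approx A (Q1 \<omega>) (Q2 \<omega>) $$ (i, j))) \<in> borel_measurable S"
      if "i < M" "j < N" for i j
    proof -
      have "(\<lambda>x. norm (A $$ (i, j) - x)) \<in> borel_measurable borel"
        by (intro borel_measurable_continuous_onI continuous_intros)
      from measurable_compose[OF meas[OF that] this] show ?thesis .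
    qed
    then have "(\<lambda>\<omega>. \<Sum>i<M. \<Sum>j<N. (norm (A $$ (i, j) - cor_approx A (Q1 \<omega>) (Q2 \<omega>) $$ (i, j)))\<^sup>2)
        \<in> borel_measurable S"
      by (intro borel_measurable_sum borel_measurable_power) auto
    then have "(\<lambda>\<omega>. sqrt (\<Sum>i<M. \<Sum>j<N. (norm (A $$ (i, j) - cor_approx A (Q1 \<omega>) (Q2 \<omega>) $$ (i, j)))\<^sup>2))
        \<in> borel_measurable S"
      by measurable
    then show ?thesis
    proof (rule measurable_cong[THEN iffD1, rotated])
      fix \<omega> assume "\<omega> \<in> space S"
      then have "dim_row (cor_approx A (Q1 \<omega>) (Q2 \<omega>)) = M" "dim_col (cor_approx A (Q1 \<omega>) (Q2 \<omega>)) = N"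
        using Q[of \<omega>] by (auto simp: cor_approx_def orthonormal_cols_def)
      then show "sqrt (\<Sum>i<M. \<Sum>j<N. (norm (A $$ (i, j) - cor_approx A (Q1 \<omega>) (Q2 \<omega>) $$ (i, j)))\<^sup>2) = ?D \<omega>"
        by (simp add: frob_norm_def)
    qed
  qed
  have D_le: "?D \<omega> \<le> frob_norm A" if "\<omega> \<in> space S" for \<omega>
    using frob_norm_cor_approx_le[OF A Q[OF that]] .
  have D_int: "integrable S ?D"
    using D_le by (intro integrable_const_bound[of _ "frob_norm A"]) auto
  have Y_meas [measurable]: "Y \<in> borel_measurable S"
    unfolding Y_def by measurable
  have Y0: "0 \<le> Y \<omega>" for \<omega> by (simp add: Y_def)
  have Y_le: "Y \<omega> \<le> frob_norm A" if "\<omega> \<in> space S" for \<omega>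
  proof -
    have "(?D \<omega> - frob_norm A0) / (1 + \<gamma>) \<le> frob_norm A / 1"
      using D_le[OF that] \<gamma> frob_norm_nonneg[of A0] frob_norm_nonneg[of A] by (intro frac_le) linarith+
    then show ?thesis by (simp add: Y_def)
  qed
  have Y_int: "integrable S Y"
    using Y_le Y0 by (intro integrable_const_bound[of _ "frob_norm A"]) auto
  have Y2_int: "integrable S (\<lambda>\<omega>. (Y \<omega>)\<^sup>2)"
    using Y_le Y0 by (intro integrable_const_bound[of _ "(frob_norm A)\<^sup>2"]) (auto intro: power_mono)
  have D_Y: "?D \<omega> \<le> frob_norm A0 + (1 + \<gamma>) * Y \<omega>" for \<omega>
  proof -
    have "(?D \<omega> - frob_norm A0) / (1 + \<gamma>) \<le> Y \<omega>" by (simp add: Y_def)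
    then show ?thesis using \<gamma> by (simp add: divide_le_eq mult.commute)
  qed
  \<comment> \<open>The pathwise bound holds for every choice of the \<open>K\<close> vectors, so
    the infimum may be taken column by column. The factors 2 come from
    \<open>(s + t)^2 <= 2 s^2 + 2 t^2\<close>.\<close>
  have Y_sq: "ennreal ((Y \<omega>)\<^sup>2) \<le> (\<Sum>k<K. min_solution_cost (2 * c\<^sup>2) (2 * b\<^sup>2) N l L k (z (w \<omega>)))"
    if \<omega>: "\<omega> \<in> space S" for \<omega>
    unfolding min_solution_cost_def
  proof (rule le_sum_INF_ennreal)
    fix r :: "nat \<Rightarrow> nat \<times> nat \<times> nat \<Rightarrow> real"
    let ?x = "\<lambda>k. qentry (r k) 0"
    let ?y = "\<lambda>k i. \<Sum>j<l. qentry (z (w \<omega>)) i j * ?x k j"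
    let ?S1 = "\<Sum>k<K. \<Sum>i<L. (norm ((if i = k then 1 else 0) - ?y k i))\<^sup>2"
    let ?S2 = "\<Sum>k<K. \<Sum>i=L..<N. (norm (?y k i))\<^sup>2"
    have Z: "(V\<^sup>H * Om \<omega>) $$ (i, j) = qentry (z (w \<omega>)) i j" if "i < N" "j < l" for i j
      unfolding z_def using that Om_entry[OF \<omega>]
      by (intro qentry_unitary_rows cV Om_carrier \<omega>) auto
    have S: "0 \<le> ?S1" "0 \<le> ?S2" by (auto intro!: sum_nonneg)
    have QR: "thin_qr M l (cor_Y A (Om \<omega>) p) (Q1 \<omega>) (R1 \<omega>)" "thin_qr N l (cor_Yhat A (Om \<omega>) p) (Q2 \<omega>) (R2 \<omega>)"
      using run[OF \<omega>] by (auto simp: cor_qurv_run_def)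
    have e1: "(\<Sum>k<K. \<Sum>i<L. (norm ((if i = k then 1 else 0) - (\<Sum>j<l. (V\<^sup>H * Om \<omega>) $$ (i, j) * ?x k j)))\<^sup>2) = ?S1"
      using L by (intro sum.cong refl arg_cong[where f = "\<lambda>t. (norm t)\<^sup>2"] arg_cong2[where f = "(-)"]) (auto simp: Z)
    have e2: "(\<Sum>k<K. \<Sum>i=L..<N. (norm (\<Sum>j<l. (V\<^sup>H * Om \<omega>) $$ (i, j) * ?x k j))\<^sup>2) = ?S2"
      by (intro sum.cong refl arg_cong[where f = "\<lambda>t. (norm t)\<^sup>2"]) (auto simp: Z)
    have \<gamma>L: "\<sigma> (L + 1) / \<sigma> K = \<gamma>" by (simp add: \<gamma>_def L_def)
    have "?D \<omega> \<le> frob_norm A0 + (1 + \<gamma>) * (c * sqrt ?S1 + b * sqrt ?S2)"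
      using frob_norm_cor_approx_residual[OF svd Om_carrier[OF \<omega>] K(1) KMN(1,2) L(1,2) pos p QR, where x = ?x]
      unfolding e1 e2 \<gamma>L A0_def c_def b_def .
    then have "(?D \<omega> - frob_norm A0) / (1 + \<gamma>) \<le> c * sqrt ?S1 + b * sqrt ?S2"
      using \<gamma> by (simp add: divide_le_eq mult.commute)
    moreover have "0 \<le> c * sqrt ?S1 + b * sqrt ?S2"
      using S nonneg \<gamma> pos by (simp add: c_def b_def)
    ultimately have "(Y \<omega>)\<^sup>2 \<le> (c * sqrt ?S1 + b * sqrt ?S2)\<^sup>2"
      using Y0 by (intro power_mono) (auto simp: Y_def)
    also have "\<dots> \<le> 2 * (c * sqrt ?S1)\<^sup>2 + 2 * (b * sqrt ?S2)\<^sup>2"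
      using sum_squares_bound[of "c * sqrt ?S1" "b * sqrt ?S2"] by (simp add: power2_sum)
    also have "\<dots> = 2 * c\<^sup>2 * ?S1 + 2 * b\<^sup>2 * ?S2"
      using S by (simp add: power_mult_distrib)
    also have "\<dots> = (\<Sum>k<K. solution_cost (2 * c\<^sup>2) (2 * b\<^sup>2) N l L k (z (w \<omega>)) (?x k))"
      by (simp add: solution_cost_def sum.distrib sum_distrib_left)
    finally have "ennreal ((Y \<omega>)\<^sup>2) \<le> ennreal \<dots>" by (rule ennreal_leI)
    then show "ennreal ((Y \<omega>)\<^sup>2) \<le> (\<Sum>k<K. ennreal (solution_cost (2 * c\<^sup>2) (2 * b\<^sup>2) N l L k (z (w \<omega>)) (?x k)))"
      by (simp add: sum_ennreal solution_cost_nonneg)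
  qed simp
  have z_meas: "z \<in> Pi\<^sub>M ?I (\<lambda>_. borel) \<rightarrow>\<^sub>M Pi\<^sub>M ?I (\<lambda>_. borel)"
  proof -
    have "(\<lambda>v. case q of (c, i, j) \<Rightarrow> qcomp c (\<Sum>m<N. qcnj (V $$ (m, i)) * qentry v m j))
        \<in> borel_measurable (Pi\<^sub>M ?I (\<lambda>_. borel))" if "q \<in> ?I" for q
      using that
      by (cases q) (auto simp: qcomp_sum qcomp_mult(1)[of _ _ "qentry _ _ _"] qcomp_qentry
          intro!: borel_measurable_sum borel_measurable_times borel_measurable_const measurable_component_singleton)
    then show ?thesis
      unfolding z_def by (intro measurable_restrict) (auto simp: case_prod_beta)
  qed
  note w = distr_indep_std_normal_mats[OF S W KMN(3,4), folded w_def]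
  have E_min: "(\<integral>\<^sup>+\<omega>. min_solution_cost (2 * c\<^sup>2) (2 * b\<^sup>2) N l L k (z (w \<omega>)) \<partial>S)
      \<le> ennreal (162 * b\<^sup>2 * real N / (real P + 1))" if "k < K" for k
  proof -
    let ?h = "min_solution_cost (2 * c\<^sup>2) (2 * b\<^sup>2) N l L k"
    have h: "?h \<in> borel_measurable (Pi\<^sub>M ?I (\<lambda>_. borel))"
      by (rule min_solution_cost_measurable[OF L(2)])
    have "(\<integral>\<^sup>+\<omega>. ?h (z (w \<omega>)) \<partial>S) = (\<integral>\<^sup>+v. ?h (z v) \<partial>distr S (Pi\<^sub>M ?I (\<lambda>_. borel)) w)"
      using measurable_compose[OF z_meas h] w(1) by (subst nn_integral_distr) auto
    also have "\<dots> = (\<integral>\<^sup>+v. ?h v \<partial>std_normals ?I)"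
      unfolding w(2) z_def by (rule nn_integral_std_normals_unitary[OF V h])
    also have "\<dots> \<le> ennreal (81 * (2 * b\<^sup>2) * (real N - real L) / (real P + 1))"
      using that L by (intro nn_integral_min_solution_cost) auto
    also have "\<dots> \<le> ennreal (162 * b\<^sup>2 * real N / (real P + 1))"
      by (intro ennreal_leI divide_right_mono) (auto intro!: mult_left_mono)
    finally show ?thesis .
  qed
  \<comment> \<open>The target for the root mean square of \<open>Y\<close>: each of the
    \<open>K\<close> columns contributes at most \<open>(\<nu> b)^2\<close> to the second
    moment.\<close>
  define s where "s = sqrt (real K) * \<nu> * b"
  have "0 \<le> b" "0 \<le> \<nu>" using nonneg \<gamma> by (auto simp: b_def \<nu>_def)
  then have "0 \<le> s" by (simp add: s_def)
  have "ennreal (expectation (\<lambda>\<omega>. (Y \<omega>)\<^sup>2)) = (\<integral>\<^sup>+\<omega>. ennreal ((Y \<omega>)\<^sup>2) \<partial>S)"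
    using Y2_int by (intro nn_integral_eq_integral[symmetric]) auto
  also have "\<dots> \<le> (\<integral>\<^sup>+\<omega>. (\<Sum>k<K. min_solution_cost (2 * c\<^sup>2) (2 * b\<^sup>2) N l L k (z (w \<omega>))) \<partial>S)"
    by (intro nn_integral_mono Y_sq)
  also have "\<dots> = (\<Sum>k<K. \<integral>\<^sup>+\<omega>. min_solution_cost (2 * c\<^sup>2) (2 * b\<^sup>2) N l L k (z (w \<omega>)) \<partial>S)"
    by (intro nn_integral_sum measurable_compose[OF w(1)] measurable_compose[OF z_meas]
        min_solution_cost_measurable L)
  also have "\<dots> \<le> (\<Sum>k<K. ennreal (162 * b\<^sup>2 * real N / (real P + 1)))"
    by (intro sum_mono E_min) simp
  also have "\<dots> = ennreal (real K * b\<^sup>2 * (162 * real N / (real P + 1)))"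
    by (subst sum_ennreal) (auto simp: mult_ac)
  \<comment> \<open>\<open>P + 1 <= N\<close> holds because \<open>K\<close> is at least 1 and
    \<open>P + K <= l <= N\<close>.\<close>
  also have "\<dots> \<le> ennreal (real K * b\<^sup>2 * \<nu>\<^sup>2)"
    using nu_sq_ge[of P N] K P unfolding \<nu>_def by (intro ennreal_leI mult_left_mono) auto
  also have "real K * b\<^sup>2 * \<nu>\<^sup>2 = s\<^sup>2"
    by (simp add: s_def power_mult_distrib)
  finally have "expectation (\<lambda>\<omega>. (Y \<omega>)\<^sup>2) \<le> s\<^sup>2"
    by (simp add: ennreal_le_iff)
  moreover have "(expectation Y)\<^sup>2 \<le> expectation (\<lambda>\<omega>. (Y \<omega>)\<^sup>2)"
    using variance_positive[of Y] variance_eq[OF Y_int Y2_int] by simp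
  ultimately have "(expectation Y)\<^sup>2 \<le> s\<^sup>2" by linarith
  then have EY: "expectation Y \<le> s"
    using \<open>0 \<le> s\<close> by (rule power2_le_imp_le)
  have "expectation ?D \<le> expectation (\<lambda>\<omega>. frob_norm A0 + (1 + \<gamma>) * Y \<omega>)"
    using D_Y Y_int D_int by (intro integral_mono) auto
  also have "\<dots> = frob_norm A0 + (1 + \<gamma>) * expectation Y"
    using Y_int by (simp add: prob_space)
  also have "\<dots> \<le> frob_norm A0 + (1 + \<gamma>) * s"
    using EY \<gamma> by (intro add_left_mono mult_left_mono) auto
  finally show ?thesis
    using D_int by (simp add: s_def b_def L_def mult_ac)
qed

end
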